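(* Let $\xi$ be a reproduction point process on $[0,\infty)$ (locally finite, with $\mathbf{P}(\xi\{0\}=1)<1$) with intensity measure $\mu$, put $\mu_+(t)=\mu((0,t])$, and let $\mu_+^{-1}(y)=\inf\{x\ge 0:\mu_+(x)\ge y\}$ for $y\ge 0$. Assume that $\mu(\{0\})=1$, that $\mu_+(t_0)<\infty$ for some $t_0>0$, and that $\mu_+(t)>0$ for all $t>0$. Assume moreover: (i) $\xi\{0\}$ is independent of the restriction $\xi(\cdot\cap(0,\infty))$. (ii) The distribution of $\xi\{0\}$ belongs to the domain of attraction of the normal distribution or, more generally, of a stable law with index $\alpha\in(1,2]$. (iii) There exist constants $t,\delta>0$ such that $\mathbf{E}[\xi(0,t]^{1+\delta}]<\infty$. (iv) There exists $\varepsilon\in(0,1)$ such that $$\int_0^\varepsilon\frac{\mu_+^{-1}(x)}{x|\log x|}\,\mathrm{d}x<\infty.$$ Then $\xi$ yields an explosive CMJ process.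
   Context: A reproduction point process $\xi$ is a random point measure on $[0,\infty)$ that is locally finite: $\xi[0,t]<\infty$ almost surely for all $t\ge 0$. Its intensity measure is $\mu(B)=\mathbf{E}[\xi(B)]$ for Borel $B$. Write $\xi=\sum_{j=1}^N\delta_{X_j}$ with $N=\xi[0,\infty)\in\mathbb{N}_0\cup\{\infty\}$ and $X_j=\inf\{t\ge 0:\xi[0,t]\ge j\}$ ($\inf\varnothing=\infty$). Crump-Mode-Jagers (CMJ) process driven by $\xi$: let $\mathcal{I}=\{\varnothing\}\cup\bigcup_{n\in\mathbb{N}}\mathbb{N}^n$ be the set of labels, and let $(\xi_u)_{u\in\mathcal{I}}$ be i.i.d. copies of $\xi$, with $X_{u,j}$ defined from $\xi_u$ as $X_j$ is from $\xi$. Birth times are $S(\varnothing)=0$ and $S(uj)=S(u)+X_{u,j}$ for $u\in\mathcal{I}$, $j\in\mathbb{N}$ (individuals with $S(u)=\infty$ are never born). Let $\mathcal{Z}_t=\#\{u\in\mathcal{I}:S(u)\le t\}$ and let $T=\inf\{t\ge 0:\mathcal{Z}_t=\infty\}\in[0,\infty]$ be the explosion time. One says that $\xi$ yields an explosive CMJ process if $\mathbf{P}(T<\infty)>0$. *)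

theory Defs
  imports "HOL-Probability.Probability"
begin

section \<open>Random point measures on the half-line\<close>

definition halfline :: "real measure" where
  "halfline = restrict_space borel {0..}"

definition point_measures :: "real measure set" where
  "point_measures =
    {\<nu>. sets \<nu> = sets halfline \<and> (\<forall>B\<in>sets halfline. emeasure \<nu> B \<in> range ennreal_of_enat)}"

text \<open>The \<open>\<sigma>\<close>-algebra on point measures generated by the evaluations \<open>\<nu> \<mapsto> \<nu>(B)\<close>, built like
  \<^const>\<open>subprob_algebra\<close>.\<close>

definition point_measure_algebra :: "real measure measure" where
  "point_measure_algebra =
    (SUP B\<in>sets halfline. vimage_algebra point_measures (\<lambda>\<nu>. emeasure \<nu> B) borel)"

lemma space_point_measure_algebra: "space point_measure_algebra = point_measures"
  by (auto simp: point_measure_algebra_def space_Sup_eq_UN)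

lemma measurable_emeasure_point_measure_algebra:
  "B \<in> sets halfline \<Longrightarrow> (\<lambda>\<nu>. emeasure \<nu> B) \<in> borel_measurable point_measure_algebra"
  by (auto intro!: measurable_Sup1 measurable_vimage_algebra1 simp: point_measure_algebra_def)

definition reproduction_point_process :: "'a measure \<Rightarrow> ('a \<Rightarrow> real measure) \<Rightarrow> bool" where
  "reproduction_point_process M \<xi> \<longleftrightarrow>
    prob_space M \<and> \<xi> \<in> measurable M point_measure_algebra \<and>
    (\<forall>t\<ge>0. AE \<omega> in M. emeasure (\<xi> \<omega>) {0..t} < \<infinity>)"

definition intensity :: "'a measure \<Rightarrow> ('a \<Rightarrow> real measure) \<Rightarrow> real measure" where
  "intensity M \<xi> = measure_of {0..} (sets halfline) (\<lambda>B. \<integral>\<^sup>+ \<omega>. emeasure (\<xi> \<omega>) B \<partial>M)"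

lemma space_halfline: "space halfline = {0..}"
  by (simp add: halfline_def space_restrict_space)

lemma sets_intensity: "sets (intensity M \<xi>) = sets halfline"
  unfolding intensity_def using sets.sigma_sets_eq[of halfline] sets.space_closed[of halfline]
  by (simp add: space_halfline)

lemma emeasure_intensity:
  assumes \<xi>: "\<xi> \<in> measurable M point_measure_algebra" and B: "B \<in> sets halfline"
  shows "emeasure (intensity M \<xi>) B = (\<integral>\<^sup>+ \<omega>. emeasure (\<xi> \<omega>) B \<partial>M)"
proof (rule emeasure_measure_of[OF intensity_def])
  show "sets halfline \<subseteq> Pow {0..}"
    using sets.space_closed[of halfline] by (simp add: space_halfline)
  show "B \<in> sets (intensity M \<xi>)"
    using B by (simp add: sets_intensity)
  show "positive (sets (intensity M \<xi>)) (\<lambda>B. \<integral>\<^sup>+ \<omega>. emeasure (\<xi> \<omega>) B \<partial>M)"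
    by (simp add: positive_def)
  show "countably_additive (sets (intensity M \<xi>)) (\<lambda>B. \<integral>\<^sup>+ \<omega>. emeasure (\<xi> \<omega>) B \<partial>M)"
  proof (rule countably_additiveI)
    fix A :: "nat \<Rightarrow> real set"
    assume A: "range A \<subseteq> sets (intensity M \<xi>)" "disjoint_family A"
    have m: "(\<lambda>\<omega>. emeasure (\<xi> \<omega>) (A i)) \<in> borel_measurable M" for i
      using measurable_compose[OF \<xi> measurable_emeasure_point_measure_algebra] A
      by (auto simp: sets_intensity)
    have s: "sets (\<xi> \<omega>) = sets halfline" if "\<omega> \<in> space M" for \<omega>
      using measurable_space[OF \<xi> that] by (simp add: space_point_measure_algebra point_measures_def)
    have "(\<Sum>i. \<integral>\<^sup>+ \<omega>. emeasure (\<xi> \<omega>) (A i) \<partial>M) = (\<integral>\<^sup>+ \<omega>. (\<Sum>i. emeasure (\<xi> \<omega>) (A i)) \<partial>M)"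
      using m by (rule nn_integral_suminf[symmetric])
    also have "\<dots> = (\<integral>\<^sup>+ \<omega>. emeasure (\<xi> \<omega>) (\<Union>i. A i) \<partial>M)"
      using A by (intro nn_integral_cong suminf_emeasure) (auto simp: sets_intensity s)
    finally show "(\<Sum>i. \<integral>\<^sup>+ \<omega>. emeasure (\<xi> \<omega>) (A i) \<partial>M) = (\<integral>\<^sup>+ \<omega>. emeasure (\<xi> \<omega>) (\<Union>i. A i) \<partial>M)" .
  qed
qed

text \<open>\<open>\<mu>\<^sub>+(t) = \<mu>((0,t])\<close> and its generalised inverse. The infimum is taken in \<open>[0,\<infinity>]\<close>, so it equals
  \<open>\<infinity>\<close> when no \<open>x\<close> qualifies.\<close>

definition mu_plus :: "real measure \<Rightarrow> real \<Rightarrow> ennreal" where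
  "mu_plus \<mu> t = emeasure \<mu> {0<..t}"

definition mu_plus_inv :: "real measure \<Rightarrow> real \<Rightarrow> ennreal" where
  "mu_plus_inv \<mu> y = (INF x\<in>{x. 0 \<le> x \<and> ennreal y \<le> mu_plus \<mu> x}. ennreal x)"

text \<open>The point measure \<open>\<nu>(\<cdot> \<inter> (0,\<infinity>))\<close>.\<close>

definition positive_part :: "real measure \<Rightarrow> real measure" where
  "positive_part \<nu> = density \<nu> (indicator {0<..})"

text \<open>Independence of two random elements with different value types; \<^const>\<open>prob_space.indep_var\<close>
  requires both to have the same type.\<close>

definition indep_elements ::
  "'a measure \<Rightarrow> 'b measure \<Rightarrow> ('a \<Rightarrow> 'b) \<Rightarrow> 'c measure \<Rightarrow> ('a \<Rightarrow> 'c) \<Rightarrow> bool" where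
  "indep_elements M S X T Y \<longleftrightarrow>
    X \<in> measurable M S \<and> Y \<in> measurable M T \<and>
    prob_space.indep_set M {X -` A \<inter> space M | A. A \<in> sets S} {Y -` B \<inter> space M | B. B \<in> sets T}"


section \<open>Stable laws and domains of attraction\<close>

text \<open>Stability in the broad sense: \<open>G\<close> is not concentrated at one point and, for i.i.d.
  \<open>Y, Y\<^sub>0, Y\<^sub>1, \<dots>\<close> with law \<open>G\<close> and every \<open>n \<ge> 1\<close>, the sum \<open>Y\<^sub>0 + \<dots> + Y\<^bsub>n-1\<^esub>\<close> is distributed as
  \<open>n\<^bsup>1/\<alpha>\<^esup> Y + d\<close> for some real \<open>d\<close>. Index \<open>\<alpha> = 2\<close> gives exactly the nondegenerate normal laws.\<close>

definition stable_law :: "real \<Rightarrow> real measure \<Rightarrow> bool" where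
  "stable_law \<alpha> G \<longleftrightarrow>
    prob_space G \<and> sets G = sets borel \<and> (\<nexists>c. G = return borel c) \<and>
    (\<forall>n\<ge>1. \<exists>d.
      distr (\<Pi>\<^sub>M i\<in>{..<n}. G) borel (\<lambda>y. \<Sum>i<n. y i) =
      distr G borel (\<lambda>y. real n powr (1 / \<alpha>) * y + d))"

definition in_domain_of_attraction :: "real measure \<Rightarrow> real measure \<Rightarrow> bool" where
  "in_domain_of_attraction F G \<longleftrightarrow>
    (\<exists>a b :: nat \<Rightarrow> real. (\<forall>n. a n > 0) \<and>
      weak_conv_m
        (\<lambda>n. distr (\<Pi>\<^sub>M i\<in>{..<n}. F) borel (\<lambda>y. ((\<Sum>i<n. y i) - b n) / a n)) G)"


section \<open>Crump-Mode-Jagers processes\<close>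

text \<open>The label \<open>uj\<close> (child \<open>j\<close> of \<open>u\<close>) is encoded as \<open>j # u\<close>, i.e. labels are read from right to
  left and \<open>[]\<close> is the ancestor. Children are numbered from \<open>1\<close>.\<close>

definition labels :: "nat list set" where
  "labels = lists {1..}"

definition nth_point :: "real measure \<Rightarrow> nat \<Rightarrow> ennreal" where
  "nth_point \<nu> j = (INF t\<in>{t. 0 \<le> t \<and> of_nat j \<le> emeasure \<nu> {0..t}}. ennreal t)"

primrec birth_time :: "(nat list \<Rightarrow> real measure) \<Rightarrow> nat list \<Rightarrow> ennreal" where
  "birth_time \<nu> [] = 0"
| "birth_time \<nu> (j # u) = birth_time \<nu> u + nth_point (\<nu> u) j"

definition population :: "(nat list \<Rightarrow> real measure) \<Rightarrow> real \<Rightarrow> ennreal" where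
  "population \<nu> t = emeasure (count_space UNIV) {u \<in> labels. birth_time \<nu> u \<le> ennreal t}"

definition explosion_time :: "(nat list \<Rightarrow> real measure) \<Rightarrow> ennreal" where
  "explosion_time \<nu> = (INF t\<in>{t. 0 \<le> t \<and> population \<nu> t = \<infinity>}. ennreal t)"

definition iid_copies ::
  "'b measure \<Rightarrow> (nat list \<Rightarrow> 'b \<Rightarrow> real measure) \<Rightarrow> 'a measure \<Rightarrow> ('a \<Rightarrow> real measure) \<Rightarrow> bool" where
  "iid_copies P \<Xi> M \<xi> \<longleftrightarrow>
    prob_space.indep_vars P (\<lambda>_. point_measure_algebra) \<Xi> labels \<and>
    (\<forall>u\<in>labels. distr P point_measure_algebra (\<Xi> u) = distr M point_measure_algebra \<xi>)"

definition explosive :: "'b measure \<Rightarrow> (nat list \<Rightarrow> 'b \<Rightarrow> real measure) \<Rightarrow> bool" where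
  "explosive P \<Xi> \<longleftrightarrow> measure P {\<omega> \<in> space P. explosion_time (\<lambda>u. \<Xi> u \<omega>) < \<infinity>} > 0"

end

theory Submission
  imports Defs
begin

text \<open>
  Let \<open>f\<close> be the generating function of \<open>X = \<xi>{0}\<close> and let \<open>\<pi>(h) =
  P(\<xi>(0,h] > 0)\<close>. If generation \<open>n+1\<close> is empty at time \<open>t\<close>, then so is generation
  \<open>n\<close> of the \<open>X\<close> subtrees rooted at time \<open>0\<close> and, if \<open>\<xi>(0,h] >
  0\<close>, generation \<open>n\<close> of a further independent subtree at its own time \<open>t - h\<close>. By (i)
  the probability of the former event is at most \<open>f(1-u) (1 - \<pi>(h) u')\<close>, where \<open>1 - u\<close>
  and \<open>1 - u'\<close> bound the corresponding probabilities for generation \<open>n\<close> at times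
  \<open>t\<close> and \<open>t - h\<close>. Hence, as soon as there are \<open>u\<^sub>k > 0\<close> and a summable
  \<open>h\<^sub>k\<close> with \<open>f(1-u\<^sub>k) (1 - \<pi>(h\<^sub>k) u\<^bsub>k+1\<^esub>) \<le> 1 -
  u\<^sub>k\<close>, every generation is reached by time \<open>\<Sum>h\<^sub>k\<close> with probability at least
  \<open>u\<^sub>0\<close>.

  Condition (ii) enters only through \<open>E X\<^sup>p < \<infinity>\<close> for some \<open>p > 1\<close>, which gives \<open>f(1-u) \<le> 1 - u + C u\<^sup>p\<close>; it is
  obtained from the decay of the characteristic function of \<open>X\<close> along the norming constants \<open>a\<^bsub>2^k\<^esub>\<close>.
  Condition (iii) bounds \<open>\<pi>(h)\<close> from below by a power of \<open>\<mu>\<^sub>+(h)\<close>. So \<open>u\<^sub>k\<close> may decay doubly exponentially, like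
  \<open>y\<^sub>k\<^sup>\<eta>\<close> with \<open>y\<^bsub>k+1\<^esub> = y\<^sub>k\<^sup>q\<close> and \<open>1 < q < p\<close>, with \<open>h\<^sub>k\<close> close to \<open>\<mu>\<^sub>+\<^sup>-\<^sup>1(y\<^sub>k)\<close>, and these are summable by (iv).
\<close>

section \<open>Moments in a domain of attraction\<close>

text \<open>Skorohod's representation turns weak convergence into pointwise convergence of random
  variables, so the integrands \<open>iexp (t n * Z n x)\<close> converge and have modulus 1. The
  moving argument \<open>t n\<close> later carries ratios of norming constants.\<close>

lemma char_tendsto_compose:
  assumes "\<And>n. real_distribution (\<mu> n)" "real_distribution G" "weak_conv_m \<mu> G" "t \<longlonglongrightarrow> \<tau>"
  shows "(\<lambda>n. char (\<mu> n) (t n)) \<longlonglongrightarrow> char G \<tau>"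
proof -
  obtain \<Omega> :: "real measure" and Z Y where ps: "prob_space \<Omega>"
    and [measurable]: "\<And>n. Z n \<in> borel_measurable \<Omega>" "Y \<in> borel_measurable \<Omega>"
    and d: "\<And>n. distr \<Omega> borel (Z n) = \<mu> n" "distr \<Omega> borel Y = G"
    and lim: "\<And>x. x \<in> space \<Omega> \<Longrightarrow> (\<lambda>n. Z n x) \<longlonglongrightarrow> Y x"
    using Skorohod[OF assms(1-3)] by fastforce
  interpret prob_space \<Omega> by fact
  have "(\<lambda>n. CLINT x|\<Omega>. iexp (t n * Z n x)) \<longlonglongrightarrow> (CLINT x|\<Omega>. iexp (\<tau> * Y x))"
    by (rule integral_dominated_convergence[where w="\<lambda>_. 1"])
      (auto intro!: tendsto_intros lim assms(4) simp del: of_real_mult)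
  moreover have "char (\<mu> n) (t n) = (CLINT x|\<Omega>. iexp (t n * Z n x))" for n
    unfolding d(1)[symmetric] char_def by (subst integral_distr) auto
  moreover have "char G \<tau> = (CLINT x|\<Omega>. iexp (\<tau> * Y x))"
    unfolding d(2)[symmetric] char_def by (subst integral_distr) auto
  ultimately show ?thesis by simp
qed

lemma (in real_distribution) integrable_iexp_mult: "integrable M (\<lambda>x. iexp (c * x))"
  by (rule integrable_const_bound[where B=1]) (auto simp del: of_real_mult)

text \<open>Centring contributes only a unimodular factor, and independence turns the rest into a
  power. Passing to moduli thus removes the centring constants from everything that follows.\<close>

lemma cmod_char_affine_sum:
  assumes "real_distribution F" "a \<noteq> 0"
  shows "cmod (char (distr (\<Pi>\<^sub>M i\<in>{..<n::nat}. F) borel (\<lambda>y. ((\<Sum>i<n. y i) - b) / a)) \<theta>) =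
    cmod (char F (\<theta> / a)) ^ n"
proof -
  interpret F: real_distribution F by fact
  interpret prod: product_prob_space "\<lambda>_::nat. F" "{..<n}" by unfold_locales
  have [measurable]: "(\<lambda>y. ((\<Sum>i<n. y i) - b) / a) \<in> borel_measurable (\<Pi>\<^sub>M i\<in>{..<n}. F)"
    by measurable
  have "char (distr (\<Pi>\<^sub>M i\<in>{..<n}. F) borel (\<lambda>y. ((\<Sum>i<n. y i) - b) / a)) \<theta> =
      (CLINT y|(\<Pi>\<^sub>M i\<in>{..<n}. F). iexp (\<theta> * (((\<Sum>i<n. y i) - b) / a)))"
    unfolding char_def by (subst integral_distr) auto
  also have "\<dots> = (CLINT y|(\<Pi>\<^sub>M i\<in>{..<n}. F). iexp (- (\<theta> * b / a)) * (\<Prod>i<n. iexp (\<theta> / a * y i)))"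
    by (intro Bochner_Integration.integral_cong refl)
      (simp add: exp_sum[symmetric] exp_add[symmetric] sum_distrib_left[symmetric] diff_divide_distrib
        algebra_simps sum_divide_distrib[symmetric])
  also have "\<dots> = iexp (- (\<theta> * b / a)) * (CLINT y|(\<Pi>\<^sub>M i\<in>{..<n}. F). (\<Prod>i<n. iexp (\<theta> / a * y i)))"
    by (rule integral_mult_right_zero)
  also have "(CLINT y|(\<Pi>\<^sub>M i\<in>{..<n}. F). (\<Prod>i<n. iexp (\<theta> / a * y i))) = (\<Prod>i<n. char F (\<theta> / a))"
    unfolding char_def by (intro prod.product_integral_prod) (use F.integrable_iexp_mult[of "\<theta> / a"] in simp_all)
  finally show ?thesis by (simp add: norm_mult norm_power del: of_real_minus of_real_mult of_real_divide)
qed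

lemma real_distribution_affine_sum:
  assumes "real_distribution F"
  shows "real_distribution (distr (\<Pi>\<^sub>M i\<in>{..<n::nat}. F) borel (\<lambda>y. ((\<Sum>i<n. y i) - b) / a))"
proof -
  interpret F: real_distribution F by fact
  interpret prod: product_prob_space "\<lambda>_::nat. F" "{..<n}" by unfold_locales
  show ?thesis
    by (intro prod.real_distribution_distr) measurable
qed

lemma stable_law_real_distribution: "stable_law \<alpha> G \<Longrightarrow> real_distribution G"
  by (auto simp: stable_law_def real_distribution_def real_distribution_axioms_def)

text \<open>The shift in the definition of stability disappears in the modulus, which leaves a pure
  scaling relation.\<close>

lemma stable_law_cmod_char:
  assumes G: "stable_law \<alpha> G" and n: "n \<ge> 1"
  shows "cmod (char G (real n powr (1 / \<alpha>) * \<theta>)) = cmod (char G \<theta>) ^ n"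
proof -
  interpret G: real_distribution G using G by (rule stable_law_real_distribution)
  obtain d where d: "distr (\<Pi>\<^sub>M i\<in>{..<n}. G) borel (\<lambda>y. \<Sum>i<n. y i) =
      distr G borel (\<lambda>y. real n powr (1 / \<alpha>) * y + d)"
    using G n unfolding stable_law_def by blast
  have "cmod (char G \<theta>) ^ n = cmod (char (distr G borel (\<lambda>y. real n powr (1 / \<alpha>) * y + d)) \<theta>)"
    using cmod_char_affine_sum[of G 1 n 0 \<theta>] by (simp add: d G.real_distribution_axioms)
  also have "char (distr G borel (\<lambda>y. real n powr (1 / \<alpha>) * y + d)) \<theta> =
      (CLINT y|G. iexp (\<theta> * (real n powr (1 / \<alpha>) * y + d)))"
    unfolding char_def by (subst integral_distr) auto
  also have "\<dots> = (CLINT y|G. iexp (\<theta> * d) * iexp (real n powr (1 / \<alpha>) * \<theta> * y))"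
    by (intro Bochner_Integration.integral_cong refl) (simp add: exp_add[symmetric] algebra_simps)
  also have "\<dots> = iexp (\<theta> * d) * char G (real n powr (1 / \<alpha>) * \<theta>)"
    unfolding char_def by (rule integral_mult_right_zero)
  finally show ?thesis by (simp add: norm_mult del: of_real_mult)
qed

section \<open>Symmetrisation and degenerate laws\<close>

text \<open>The squared modulus is the characteristic function of the difference D of two
  independent copies, hence equal to E cos(\<theta> D). The proof expands the cosine of the
  difference and factorises over the product measure.\<close>

lemma (in real_distribution) symmetrised_char:
  "1 - (cmod (char M \<theta>))\<^sup>2 = (\<integral>z. 1 - cos (\<theta> * (fst z - snd z)) \<partial>(M \<Otimes>\<^sub>M M))"
proof -
  interpret pair_prob_space M M by unfold_locales
  note i = integrable_iexp_mult[of \<theta>]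
  have re: "Re (char M \<theta>) = (\<integral>x. cos (\<theta> * x) \<partial>M)" "Im (char M \<theta>) = (\<integral>x. sin (\<theta> * x) \<partial>M)"
    using integral_Re[OF i] integral_Im[OF i] by (simp_all add: char_def Re_exp Im_exp)
  have ip: "integrable (M \<Otimes>\<^sub>M M) (\<lambda>z. f (fst z) * f (snd z))"
      "(\<integral>z. f (fst z) * f (snd z) \<partial>(M \<Otimes>\<^sub>M M)) = (\<integral>x. f x \<partial>M)\<^sup>2"
    if f: "f \<in> borel_measurable borel" "\<And>x. \<bar>f x\<bar> \<le> 1" for f :: "real \<Rightarrow> real"
  proof -
    note [measurable] = f(1)
    have "\<bar>f x * f y\<bar> \<le> 1" for x y
      using mult_mono[OF f(2)[of x] f(2)[of y]] by (simp add: abs_mult)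
    then show *: "integrable (M \<Otimes>\<^sub>M M) (\<lambda>z. f (fst z) * f (snd z))"
      by (intro P.integrable_const_bound[where B=1]) (auto simp: split_beta)
    show "(\<integral>z. f (fst z) * f (snd z) \<partial>(M \<Otimes>\<^sub>M M)) = (\<integral>x. f x \<partial>M)\<^sup>2"
      using integral_fst'[OF *] by (simp add: power2_eq_square)
  qed
  have "(\<integral>z. 1 - cos (\<theta> * (fst z - snd z)) \<partial>(M \<Otimes>\<^sub>M M)) =
    (\<integral>z. 1 - (cos (\<theta> * fst z) * cos (\<theta> * snd z) + sin (\<theta> * fst z) * sin (\<theta> * snd z)) \<partial>(M \<Otimes>\<^sub>M M))"
    by (simp add: right_diff_distrib cos_diff)
  also have "\<dots> = 1 - ((\<integral>x. cos (\<theta> * x) \<partial>M)\<^sup>2 + (\<integral>x. sin (\<theta> * x) \<partial>M)\<^sup>2)"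
    using ip[of "\<lambda>x. cos (\<theta> * x)"] ip[of "\<lambda>x. sin (\<theta> * x)"] by (simp add: P.prob_space del: space_pair_measure)
  finally show ?thesis by (simp add: cmod_power2 re)
qed

text \<open>By \<open>symmetrised_char\<close> the nonnegative variable 1 - cos(s D) has mean 0, so
  it vanishes almost surely, simultaneously for countably many s tending to 0. If D \<noteq> 0, some
  such s satisfies 0 < s |D| < 1, where the cosine is less than 1.\<close>

lemma (in real_distribution) symmetrised_degenerate:
  assumes s0: "s0 > 0" and one: "\<And>s. 0 < s \<Longrightarrow> s < s0 \<Longrightarrow> cmod (char M s) = 1"
  shows "AE z in M \<Otimes>\<^sub>M M. fst z = snd z"
proof -
  interpret pair_prob_space M M by unfold_locales
  have "AE z in M \<Otimes>\<^sub>M M. 1 - cos (s0 / (real n + 2) * (fst z - snd z)) = 0" for n :: nat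
  proof -
    have i: "integrable (M \<Otimes>\<^sub>M M) (\<lambda>z. 1 - cos (s0 / (real n + 2) * (fst z - snd z)))"
      by (rule P.integrable_const_bound[where B=2])
        (auto simp: abs_le_iff intro!: AE_I2 order_trans[OF cos_le_one] split: abs_split)
    \<comment> \<open>The offset 2 keeps the scale strictly below \<open>s0\<close> even for n =
      0.\<close>
    have "s0 / (real n + 2) < s0"
      using s0 by (simp add: divide_less_eq algebra_simps add_pos_nonneg)
    then show ?thesis
      using symmetrised_char[of "s0 / (real n + 2)"] one[of "s0 / (real n + 2)"] s0 i
      by (simp add: integral_nonneg_eq_0_iff_AE)
  qed
  then have "AE z in M \<Otimes>\<^sub>M M. \<forall>n::nat. 1 - cos (s0 / (real n + 2) * (fst z - snd z)) = 0"
    by (simp add: AE_all_countable)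
  then show ?thesis
  proof (eventually_elim)
    case (elim z)
    show ?case
    proof (rule ccontr)
      assume "fst z \<noteq> snd z"
      define d where "d = \<bar>fst z - snd z\<bar>"
      have d: "d > 0" using \<open>fst z \<noteq> snd z\<close> by (simp add: d_def)
      obtain n :: nat where n: "s0 * d < real n" using reals_Archimedean2 by blast
      define x where "x = s0 / (real n + 2) * d"
      have "0 < x" "x < 1"
        using s0 d n by (simp_all add: x_def field_simps)
      then have "sin (x / 2) > 0" using pi_gt3 by (intro sin_gt_zero) auto
      moreover have "x = \<bar>s0 / (real n + 2) * (fst z - snd z)\<bar>"
        using s0 by (simp add: d_def x_def abs_mult)
      then have "cos x = 1"
        using elim[rule_format, of n] by (simp only: cos_abs_real)
      ultimately show False using cos_double_sin[of "x / 2"] by simp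
    qed
  qed
qed

text \<open>A modulus identically 1 makes two independent copies agree almost surely. Fubini then
  yields one value taken almost surely, and \<open>stable_law\<close> excludes point masses.\<close>

lemma stable_law_char_nontrivial:
  assumes "stable_law \<alpha> G" shows "\<exists>\<theta>. cmod (char G \<theta>) \<noteq> 1"
proof (rule ccontr)
  interpret G: real_distribution G using assms by (rule stable_law_real_distribution)
  interpret pair_prob_space G G by unfold_locales
  assume "\<nexists>\<theta>. cmod (char G \<theta>) \<noteq> 1"
  then have "AE z in G \<Otimes>\<^sub>M G. fst z = snd z"
    by (intro G.symmetrised_degenerate[of 1]) auto
  then have "AE x in G. AE y in G. x = y"
    using AE_pair by fastforce
  then obtain c where "AE y in G. c = y"
    using G.AE_E_prob[of "\<lambda>x. AE y in G. x = y"] G.not_empty eventually_happens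
    by (metis (no_types, lifting) G.prob_space_axioms prob_space.ae_filter_bot trivial_limit_def)
  then have "distr G borel (\<lambda>y. y) = distr G borel (\<lambda>_. c)"
    by (intro distr_cong_AE) auto
  moreover have "distr G borel (\<lambda>y. y) = G"
    using distr_id2[of borel G] by simp
  ultimately have "G = return borel c" by simp
  then show False using assms by (auto simp: stable_law_def)
qed

section \<open>Growth of the norming constants\<close>

lemma weak_conv_m_subseq: "weak_conv_m \<mu> G \<Longrightarrow> strict_mono s \<Longrightarrow> weak_conv_m (\<lambda>n. \<mu> (s n)) G"
  unfolding weak_conv_m_def weak_conv_def
  using LIMSEQ_subseq_LIMSEQ[of "\<lambda>n. cdf (\<mu> n) x" "cdf G x" s for x] by (simp add: comp_def)

text \<open>Index and argument are both left free: below, the indices run through extracted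
  subsequences, their doubles and powers of 2, and the arguments may involve the norming constants
  themselves.\<close>

lemma attraction_cmod_char_tendsto:
  fixes a b :: "nat \<Rightarrow> real"
  assumes F: "real_distribution F" and G: "real_distribution G" and a: "\<And>n. a n > 0"
    and conv: "weak_conv_m
        (\<lambda>n. distr (\<Pi>\<^sub>M i\<in>{..<n}. F) borel (\<lambda>y. ((\<Sum>i<n. y i) - b n) / a n)) G"
    and s: "strict_mono s" and t: "t \<longlonglongrightarrow> \<tau>"
  shows "(\<lambda>n. cmod (char F (t n / a (s n))) ^ s n) \<longlonglongrightarrow> cmod (char G \<tau>)"
proof -
  have "(\<lambda>n. cmod (char (distr (\<Pi>\<^sub>M i\<in>{..<s n}. F) borel
      (\<lambda>y. ((\<Sum>i<s n. y i) - b (s n)) / a (s n))) (t n))) \<longlonglongrightarrow> cmod (char G \<tau>)"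
    by (intro tendsto_norm char_tendsto_compose[OF _ G weak_conv_m_subseq[OF conv s] t]
        real_distribution_affine_sum F)
  moreover have "a n \<noteq> 0" for n using a[of n] by simp
  ultimately show ?thesis by (simp add: cmod_char_affine_sum F)
qed

text \<open>Otherwise a limit point \<open>\<rho>\<close> of \<open>a\<^sub>n / a\<^bsub>2n\<^esub>\<close> yields \<open>\<sigma> = 2\<^bsup>1/\<alpha>\<^esup> \<rho> < 1\<close> such that the modulus of the
  characteristic function of \<open>G\<close> is invariant under \<open>\<theta> \<mapsto> \<sigma>\<theta>\<close>, hence equal to its value \<open>1\<close> at \<open>0\<close>.\<close>

lemma attraction_scale_ratio:
  fixes a b :: "nat \<Rightarrow> real"
  assumes F: "real_distribution F" and G: "stable_law \<alpha> G" and a: "\<And>n. a n > 0"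
    and conv: "weak_conv_m
        (\<lambda>n. distr (\<Pi>\<^sub>M i\<in>{..<n}. F) borel (\<lambda>y. ((\<Sum>i<n. y i) - b n) / a n)) G"
    and p: "0 < p" "p < \<alpha>"
  shows "\<forall>\<^sub>F n in sequentially. a (2 * n) \<le> 2 powr (1 / p) * a n"
proof (rule ccontr)
  interpret G: real_distribution G using G by (rule stable_law_real_distribution)
  note lim = attraction_cmod_char_tendsto[OF F G.real_distribution_axioms a conv]
  assume "\<not> ?thesis"
  then have "\<exists>\<^sub>F n in sequentially. a (2 * n) > 2 powr (1 / p) * a n"
    by (simp add: not_eventually not_le)
  then have "infinite {n. a (2 * n) > 2 powr (1 / p) * a n}"
    by (simp add: cofinite_eq_sequentially[symmetric] frequently_cofinite)
  then obtain s :: "nat \<Rightarrow> nat" where s: "strict_mono s"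
    and big: "\<And>n. a (2 * s n) > 2 powr (1 / p) * a (s n)"
    using infinite_enumerate by (metis (mono_tags, lifting) mem_Collect_eq)
  define \<rho> where "\<rho> n = a (s n) / a (2 * s n)" for n
  have \<rho>: "\<rho> n \<in> {0..2 powr (- (1 / p))}" for n
    using big[of n] a[of "s n"] a[of "2 * s n"]
    by (auto simp: \<rho>_def powr_minus field_simps intro: less_imp_le)
  have "seq_compact {0..2 powr (- (1 / p)) :: real}"
    by (simp add: compact_imp_seq_compact)
  then obtain r \<rho>' where r: "strict_mono r" and \<rho>': "\<rho>' \<in> {0..2 powr (- (1 / p))}" "(\<lambda>n. \<rho> (r n)) \<longlonglongrightarrow> \<rho>'"
    using \<rho> unfolding seq_compact_def comp_def by metis
  have sr: "strict_mono (\<lambda>n. s (r n))" "strict_mono (\<lambda>n. 2 * s (r n))"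
    using s r by (auto simp: strict_mono_def)
  define \<sigma> where "\<sigma> = 2 powr (1 / \<alpha>) * \<rho>'"
  have \<sigma>: "0 \<le> \<sigma>" "\<sigma> < 1"
  proof -
    have "\<sigma> \<le> 2 powr (1 / \<alpha>) * 2 powr (- (1 / p))"
      using \<rho>'(1) by (auto simp: \<sigma>_def)
    also have "\<dots> = 2 powr (1 / \<alpha> - 1 / p)"
      by (simp add: powr_add[symmetric])
    also have "\<dots> < 1"
      using p by (intro powr_less_one) (auto simp: field_simps)
    finally show "\<sigma> < 1" .
  qed (use \<rho>' in \<open>auto simp: \<sigma>_def\<close>)
  \<comment> \<open>The point \<open>\<theta> * \<rho> n / a (s n)\<close> equals
    \<open>\<theta> / a (2 * s n)\<close>, so squaring the modulus for index \<open>s n\<close>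
    gives the modulus for index \<open>2 * s n\<close>. Comparing the two limits, stability with n =
    2 turns the square into the scale 2^(1/\<alpha>).\<close>
  have inv: "cmod (char G (\<sigma> * \<theta>)) = cmod (char G \<theta>)" for \<theta>
  proof -
    have "(\<lambda>n. (cmod (char F (\<theta> * \<rho> (r n) / a (s (r n)))) ^ s (r n))\<^sup>2) \<longlonglongrightarrow> (cmod (char G (\<theta> * \<rho>')))\<^sup>2"
      by (intro tendsto_power lim[OF sr(1)] tendsto_mult tendsto_const \<rho>'(2))
    moreover have "(cmod (char F (\<theta> * \<rho> (r n) / a (s (r n)))) ^ s (r n))\<^sup>2 =
        cmod (char F (\<theta> / a (2 * s (r n)))) ^ (2 * s (r n))" for n
      using a[of "s (r n)"] a[of "2 * s (r n)"]
      by (simp add: \<rho>_def power_mult[symmetric] mult.commute)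
    ultimately have "(cmod (char G (\<theta> * \<rho>')))\<^sup>2 = cmod (char G \<theta>)"
      using lim[OF sr(2) tendsto_const[of \<theta>]] by (simp add: LIMSEQ_unique)
    moreover have "(cmod (char G (\<theta> * \<rho>')))\<^sup>2 = cmod (char G (\<sigma> * \<theta>))"
      using stable_law_cmod_char[OF G, of 2 "\<theta> * \<rho>'"] by (simp add: \<sigma>_def mult_ac)
    ultimately show ?thesis by simp
  qed
  have "cmod (char G \<theta>) = 1" for \<theta>
  proof -
    have "cmod (char G (\<sigma> ^ k * \<theta>)) = cmod (char G \<theta>)" for k
      using inv[of "\<sigma> ^ k * \<theta>" for k] by (induction k) (auto simp: mult.assoc)
    moreover have "(\<lambda>k. cmod (char G (\<sigma> ^ k * \<theta>))) \<longlonglongrightarrow> cmod (char G (0 * \<theta>))"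
      using \<sigma> by (intro tendsto_norm isCont_tendsto_compose[OF G.isCont_char] tendsto_mult
          LIMSEQ_power_zero tendsto_const) auto
    ultimately show ?thesis
      by (simp add: LIMSEQ_const_iff G.char_zero)
  qed
  then show False using stable_law_char_nontrivial[OF G] by simp
qed

section \<open>Moments from the decay of the characteristic function\<close>

lemma one_minus_cos_lower:
  fixes x :: real
  assumes "1 / 2 \<le> x" "x \<le> 1"
  shows "1 - cos x \<ge> 1 - cos (1 / 2)"
  using assms pi_gt3 by (simp add: cos_mono_le_eq)

lemma one_minus_cos_half_pos: "1 - cos (1 / 2 :: real) > 0"
  using cos_monotone_0_pi[of 0 "1 / 2"] pi_gt3 by simp

text \<open>By Fubini there is a fixed x for which |x - Y| has a finite moment of order r, and then
  |y|^r \<le> 2^r (|x - y|^r + |x|^r).\<close>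

lemma (in real_distribution) finite_moment_if_symmetrised:
  assumes r: "r > 0" and fin: "(\<integral>\<^sup>+z. ennreal (\<bar>fst z - snd z\<bar> powr r) \<partial>(M \<Otimes>\<^sub>M M)) < \<infinity>"
  shows "(\<integral>\<^sup>+x. ennreal (\<bar>x\<bar> powr r) \<partial>M) < \<infinity>"
proof -
  have "(\<integral>\<^sup>+x. \<integral>\<^sup>+y. ennreal (\<bar>x - y\<bar> powr r) \<partial>M \<partial>M) < \<infinity>"
    using fin by (subst (asm) nn_integral_fst[symmetric]) auto
  then have "AE x in M. (\<integral>\<^sup>+y. ennreal (\<bar>x - y\<bar> powr r) \<partial>M) \<noteq> \<infinity>"
    by (intro nn_integral_PInf_AE) auto
  then have "\<exists>x. (\<integral>\<^sup>+y. ennreal (\<bar>x - y\<bar> powr r) \<partial>M) \<noteq> \<infinity>"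
    using eventually_happens[of _ "ae_filter M"] ae_filter_bot by blast
  then obtain x where x: "(\<integral>\<^sup>+y. ennreal (\<bar>x - y\<bar> powr r) \<partial>M) < \<infinity>"
    by (auto simp: less_top)
  have "\<bar>y\<bar> powr r \<le> 2 powr r * \<bar>x - y\<bar> powr r + 2 powr r * \<bar>x\<bar> powr r" for y
  proof -
    have "\<bar>y\<bar> powr r \<le> (2 * max \<bar>x - y\<bar> \<bar>x\<bar>) powr r"
      using r abs_triangle_ineq[of x "y - x"] by (intro powr_mono2) (auto simp: max_def abs_minus_commute)
    also have "\<dots> = 2 powr r * max \<bar>x - y\<bar> \<bar>x\<bar> powr r"
      by (simp add: powr_mult)
    also have "\<dots> \<le> 2 powr r * (\<bar>x - y\<bar> powr r + \<bar>x\<bar> powr r)"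
      by (intro mult_left_mono) (auto simp: max_def)
    finally show ?thesis by (simp add: distrib_left)
  qed
  then have "(\<integral>\<^sup>+y. ennreal (\<bar>y\<bar> powr r) \<partial>M) \<le>
      (\<integral>\<^sup>+y. ennreal (2 powr r) * ennreal (\<bar>x - y\<bar> powr r) + ennreal (2 powr r * \<bar>x\<bar> powr r) \<partial>M)"
    by (intro nn_integral_mono)
      (simp add: ennreal_mult'[symmetric] ennreal_plus[symmetric] del: ennreal_plus)
  also have "\<dots> = ennreal (2 powr r) * (\<integral>\<^sup>+y. ennreal (\<bar>x - y\<bar> powr r) \<partial>M) + ennreal (2 powr r * \<bar>x\<bar> powr r)"
    by (simp add: nn_integral_add nn_integral_cmult emeasure_space_1 del: space_eq_univ)
  also have "\<dots> < \<infinity>"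
    using x by (simp add: ennreal_mult_less_top)
  finally show ?thesis .
qed

text \<open>The scales are unbounded and at most double. If \<theta> |d| exceeds \<open>B 0\<close>,
  the first scale \<open>B i\<close> that reaches it therefore puts \<theta> |d| /
  \<open>B i\<close> into [1/2, 1], where 1 - cos is bounded below. This single term already
  dominates |d|^r; smaller |d| are covered by the constant.\<close>

lemma abs_powr_le_suminf_cos:
  fixes B :: "nat \<Rightarrow> real"
  assumes B: "\<And>i. B i > 0" "\<And>i. B (Suc i) \<le> 2 * B i" "\<And>x. \<exists>i. x \<le> B i"
    and r: "r > 0" and \<theta>: "\<theta> > 0"
  shows "ennreal (\<bar>d\<bar> powr r) \<le> ennreal ((B 0 / \<theta>) powr r) +
    ennreal (1 / (\<theta> powr r * (1 - cos (1 / 2)))) * (\<Sum>i. ennreal (B i powr r) * ennreal (1 - cos (\<theta> / B i * d)))"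
    (is "_ \<le> _ + ?c * (\<Sum>i. ?f i)")
proof (cases "\<theta> * \<bar>d\<bar> \<le> B 0")
  case True
  then have "\<bar>d\<bar> powr r \<le> (B 0 / \<theta>) powr r"
    using r \<theta> by (intro powr_mono2) (auto simp: field_simps)
  then show ?thesis by (intro order_trans[OF ennreal_leI add_increasing2]) auto
next
  case False
  define i where "i = (LEAST i. \<theta> * \<bar>d\<bar> \<le> B i)"
  have i: "\<theta> * \<bar>d\<bar> \<le> B i" unfolding i_def using B(3) by (rule LeastI_ex)
  then have "i \<noteq> 0" using False by (metis)
  then obtain j where j: "i = Suc j" by (cases i) auto
  then have "\<theta> * \<bar>d\<bar> > B j"
    using not_less_Least[of j "\<lambda>i. \<theta> * \<bar>d\<bar> \<le> B i"] unfolding i_def[symmetric] by auto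
  then have i2: "B i \<le> 2 * (\<theta> * \<bar>d\<bar>)" using B(2)[of j] j by simp
  have "1 / 2 \<le> \<bar>\<theta> / B i * d\<bar>" "\<bar>\<theta> / B i * d\<bar> \<le> 1"
    using i i2 B(1)[of i] \<theta> by (simp_all add: abs_mult field_simps)
  from one_minus_cos_lower[OF this] have c: "1 - cos (\<theta> / B i * d) \<ge> 1 - cos (1 / 2)"
    by (simp only: cos_abs_real)
  have "\<bar>d\<bar> powr r = (\<theta> * \<bar>d\<bar>) powr r / \<theta> powr r"
    using \<theta> by (simp add: powr_mult)
  also have "\<dots> \<le> B i powr r / \<theta> powr r"
    using i r \<theta> by (intro divide_right_mono powr_mono2) auto
  also have "\<dots> = 1 / (\<theta> powr r * (1 - cos (1 / 2))) * (B i powr r * (1 - cos (1 / 2)))"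
    using one_minus_cos_half_pos by simp
  also have "\<dots> \<le> 1 / (\<theta> powr r * (1 - cos (1 / 2))) * (B i powr r * (1 - cos (\<theta> / B i * d)))"
    using c one_minus_cos_half_pos by (intro mult_left_mono) auto
  finally have "ennreal (\<bar>d\<bar> powr r) \<le> ?c * ?f i"
    using one_minus_cos_half_pos by (simp add: ennreal_mult'[symmetric] ennreal_leI)
  also have "?f i \<le> (\<Sum>i. ?f i)"
    using sum_le_suminf[of ?f "{i}"] by simp
  finally show ?thesis
    by (simp add: mult_left_mono add_increasing)
qed

text \<open>If the scales \<open>a\<^bsub>2^k\<^esub>\<close> stay bounded, \<open>F\<close> is a point mass. Otherwise
  \<open>E (1 - cos (\<theta> D / a\<^bsub>2^k\<^esub>)) = O(2\<^sup>-\<^sup>k)\<close> for the symmetrised variable \<open>D\<close>, and weighting this with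
  \<open>a\<^bsub>2^k\<^esub>\<^sup>r\<close> and summing over \<open>k\<close> dominates \<open>E |D|\<^sup>r\<close>.\<close>

lemma attraction_symmetrised_moment:
  fixes a b :: "nat \<Rightarrow> real"
  assumes F: "real_distribution F" and G: "stable_law \<alpha> G" and a: "\<And>n. a n > 0"
    and conv: "weak_conv_m
        (\<lambda>n. distr (\<Pi>\<^sub>M i\<in>{..<n}. F) borel (\<lambda>y. ((\<Sum>i<n. y i) - b n) / a n)) G"
    and r: "0 < r" "r < \<alpha>" and \<alpha>: "1 < \<alpha>"
  shows "(\<integral>\<^sup>+z. ennreal (\<bar>fst z - snd z\<bar> powr r) \<partial>(F \<Otimes>\<^sub>M F)) < \<infinity>"
proof -
  interpret F: real_distribution F by fact
  interpret G: real_distribution G using G by (rule stable_law_real_distribution)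
  interpret pair_prob_space F F by unfold_locales
  note lim = attraction_cmod_char_tendsto[OF F G.real_distribution_axioms a conv]
  have s2: "strict_mono (\<lambda>k::nat. 2 ^ k :: nat)" by (simp add: strict_mono_def)
  show ?thesis
  proof (cases "\<exists>L. \<forall>k. a (2 ^ k) \<le> L")
    case True
    then obtain L where L: "\<And>k. a (2 ^ k) \<in> {0..L}" using a by (auto intro: less_imp_le)
    have "seq_compact {0..L}" by (simp add: compact_imp_seq_compact)
    then obtain s \<beta> where s: "strict_mono s" and \<beta>: "(\<lambda>k. a (2 ^ s k)) \<longlonglongrightarrow> \<beta>"
      by (rule seq_compactE[where f="\<lambda>k. a (2 ^ k)"]) (use L in \<open>auto simp: comp_def\<close>)
    have ss: "strict_mono (\<lambda>k. 2 ^ s k :: nat)" using s by (simp add: strict_mono_def)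
    have "(\<lambda>x. cmod (char G (x * \<beta>))) \<midarrow>0\<rightarrow> cmod (char G (0 * \<beta>))"
      by (intro tendsto_norm isCont_tendsto_compose[OF G.isCont_char] tendsto_intros)
    then have "\<forall>\<^sub>F x in at 0. cmod (char G (x * \<beta>)) > 0"
      by (intro order_tendstoD) (auto simp: G.char_zero)
    then obtain s0 where s0: "s0 > 0" "\<And>x. x \<noteq> 0 \<Longrightarrow> \<bar>x\<bar> < s0 \<Longrightarrow> cmod (char G (x * \<beta>)) > 0"
      by (auto simp: eventually_at dist_real_def)
    \<comment> \<open>With the argument \<open>x * a (2 ^ s k)\<close> the norming cancels, so
      powers of the fixed number \<open>cmod (char F x)\<close> converge to a limit that is positive
      for small x. This forces the number to be 1.\<close>
    have "AE z in F \<Otimes>\<^sub>M F. fst z = snd z"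
    proof (rule F.symmetrised_degenerate[OF s0(1)])
      fix x assume x: "0 < x" "x < s0"
      have "(\<lambda>k. cmod (char F (x * a (2 ^ s k) / a (2 ^ s k))) ^ (2 ^ s k)) \<longlonglongrightarrow> cmod (char G (x * \<beta>))"
        by (intro lim[OF ss] tendsto_intros \<beta>)
      moreover have "x * a (2 ^ s k) / a (2 ^ s k) = x" for k using a[of "2 ^ s k"] by simp
      ultimately have l: "(\<lambda>k. cmod (char F x) ^ (2 ^ s k)) \<longlonglongrightarrow> cmod (char G (x * \<beta>))" by simp
      show "cmod (char F x) = 1"
      proof (rule ccontr)
        assume "cmod (char F x) \<noteq> 1"
        then have "cmod (char F x) < 1" using F.cmod_char_le_1[of x] by simp
        then have "(\<lambda>k. cmod (char F x) ^ k) \<longlonglongrightarrow> 0"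
          by (intro LIMSEQ_power_zero) simp
        from LIMSEQ_subseq_LIMSEQ[OF this ss] have "cmod (char G (x * \<beta>)) = 0"
          using l by (intro LIMSEQ_unique[OF l]) (simp add: comp_def)
        then show False using s0(2)[of x] x by simp
      qed
    qed
    then have "(\<integral>\<^sup>+z. ennreal (\<bar>fst z - snd z\<bar> powr r) \<partial>(F \<Otimes>\<^sub>M F)) = (\<integral>\<^sup>+z. 0 \<partial>(F \<Otimes>\<^sub>M F))"
      by (intro nn_integral_cong_AE) auto
    then show ?thesis by simp
  next
    case unb: False
    \<comment> \<open>The exponent lies strictly between max(1, r) and \<alpha>: p < \<alpha> for
      \<open>attraction_scale_ratio\<close>, p > 1 so that the scales at most double, and p > r for
      the final geometric series.\<close>
    define p where "p = (max 1 r + \<alpha>) / 2"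
    have p: "0 < p" "p < \<alpha>" "r < p" "1 < p" using r \<alpha> by (auto simp: p_def)
    have "(\<lambda>x. cmod (char G x)) \<midarrow>0\<rightarrow> cmod (char G 0)"
      by (intro tendsto_norm isCont_tendsto_compose[OF G.isCont_char] tendsto_intros)
    then have "\<forall>\<^sub>F x in at 0. cmod (char G x) > 0"
      by (intro order_tendstoD) (auto simp: G.char_zero)
    then obtain s0 where s0: "s0 > 0" "\<And>x. x \<noteq> 0 \<Longrightarrow> \<bar>x\<bar> < s0 \<Longrightarrow> cmod (char G x) > 0"
      by (auto simp: eventually_at dist_real_def)
    define \<theta> where "\<theta> = s0 / 2"
    define c where "c = cmod (char G \<theta>) / 2"
    have \<theta>: "\<theta> > 0" and c: "c > 0" "c < cmod (char G \<theta>)" using s0 by (auto simp: \<theta>_def c_def)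
    have "\<forall>\<^sub>F k in sequentially. cmod (char F (\<theta> / a (2 ^ k))) ^ (2 ^ k) > c"
      by (rule order_tendstoD(1)[OF lim[OF s2 tendsto_const] c(2)])
    moreover have "\<forall>\<^sub>F k in sequentially. a (2 * 2 ^ k) \<le> 2 powr (1 / p) * a (2 ^ k)"
      using attraction_scale_ratio[OF F G a conv p(1,2)] filterlim_subseq[OF s2]
      by (rule eventually_compose_filterlim)
    ultimately have "\<forall>\<^sub>F k in sequentially. cmod (char F (\<theta> / a (2 ^ k))) ^ (2 ^ k) > c \<and>
        a (2 * 2 ^ k) \<le> 2 powr (1 / p) * a (2 ^ k)"
      by eventually_elim simp
    then obtain k0 where k0: "\<And>k. k \<ge> k0 \<Longrightarrow> cmod (char F (\<theta> / a (2 ^ k))) ^ (2 ^ k) > c"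
        "\<And>k. k \<ge> k0 \<Longrightarrow> a (2 * 2 ^ k) \<le> 2 powr (1 / p) * a (2 ^ k)"
      by (auto simp: eventually_sequentially)
    \<comment> \<open>Starting at \<open>k0\<close> discards the scales at which the eventual bounds
      may fail.\<close>
    define B where "B i = a (2 ^ (k0 + i))" for i
    define C where "C = - 2 * ln c"
    have Bpos: "B i > 0" for i by (simp add: B_def a)
    have Bsuc: "B (Suc i) \<le> 2 powr (1 / p) * B i" for i
      using k0(2)[of "k0 + i"] by (simp add: B_def)
    have Bsuc2: "B (Suc i) \<le> 2 * B i" for i
    proof -
      have "2 powr (1 / p) \<le> 2 powr (1::real)" using p by (intro powr_mono) auto
      then have "2 powr (1 / p) * B i \<le> 2 * B i" using Bpos[of i] by (intro mult_right_mono) auto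
      then show ?thesis using Bsuc[of i] by simp
    qed
    have Bunb: "\<exists>i. x \<le> B i" for x
    proof (rule ccontr)
      assume *: "\<nexists>i. x \<le> B i"
      have "a (2 ^ k) \<le> max x (Max ((\<lambda>k. a (2 ^ k)) ` {..k0}))" for k
      proof (cases "k \<le> k0")
        case False
        then have "a (2 ^ k) = B (k - k0)" by (simp add: B_def)
        then have "a (2 ^ k) \<le> x" using * by (metis linorder_le_cases)
        then show ?thesis by simp
      qed (auto intro!: max.coboundedI2 Max_ge)
      then show False using unb by blast
    qed
    have Bgrow: "B i \<le> B 0 * (2 powr (1 / p)) ^ i" for i
    proof (induction i)
      case (Suc i)
      have "2 powr (1 / p) * B i \<le> 2 powr (1 / p) * (B 0 * (2 powr (1 / p)) ^ i)"
        using Suc by (intro mult_left_mono) auto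
      from order_trans[OF Bsuc[of i] this] show ?case by (simp add: mult_ac)
    qed simp
    \<comment> \<open>If x is the modulus, x^(2^(k0+i)) > c gives -ln x \<le> -ln c / 2^i, and 1 -
      x^2 \<le> -2 ln x. This is the origin of \<open>C\<close>.\<close>
    have K: "1 - (cmod (char F (\<theta> / B i)))\<^sup>2 \<le> C / 2 ^ i" for i
    proof -
      define x where "x = cmod (char F (\<theta> / B i))"
      have x: "x ^ (2 ^ (k0 + i)) > c" using k0(1)[of "k0 + i"] by (simp add: x_def B_def)
      have "x \<noteq> 0" using x c by (auto simp: power_0_left)
      then have x0: "x > 0" "x \<le> 1" using F.cmod_char_le_1 by (auto simp: x_def)
      have "ln c < ln (x ^ (2 ^ (k0 + i)))" using x c x0 by (subst ln_less_cancel_iff) auto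
      also have "\<dots> = 2 ^ (k0 + i) * ln x" using x0 by (simp add: ln_realpow)
      also have "\<dots> \<le> 2 ^ i * ln x"
        using x0 by (intro mult_right_mono_neg power_increasing) auto
      finally have "- ln x \<le> - ln c / 2 ^ i" by (simp add: field_simps)
      moreover have "ln (x\<^sup>2) \<le> x\<^sup>2 - 1" using x0 by (intro ln_le_minus_one) simp
      ultimately show ?thesis using x0 by (simp add: C_def x_def[symmetric] ln_realpow)
    qed
    have int1: "integrable (F \<Otimes>\<^sub>M F) (\<lambda>z. 1 - cos (t * (fst z - snd z)))" for t
      by (rule P.integrable_const_bound[where B=2])
        (auto simp: abs_le_iff intro!: AE_I2 order_trans[OF cos_le_one] split: abs_split)
    define \<kappa> where "\<kappa> = 1 / (\<theta> powr r * (1 - cos (1 / 2)))"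
    have "(\<integral>\<^sup>+z. ennreal (\<bar>fst z - snd z\<bar> powr r) \<partial>(F \<Otimes>\<^sub>M F)) \<le>
        (\<integral>\<^sup>+z. ennreal ((B 0 / \<theta>) powr r) + ennreal \<kappa> * (\<Sum>i. ennreal (B i powr r) *
          ennreal (1 - cos (\<theta> / B i * (fst z - snd z)))) \<partial>(F \<Otimes>\<^sub>M F))"
      unfolding \<kappa>_def by (intro nn_integral_mono abs_powr_le_suminf_cos Bpos Bsuc2 Bunb r \<theta>)
    also have "\<dots> = ennreal ((B 0 / \<theta>) powr r) + ennreal \<kappa> * (\<Sum>i. ennreal (B i powr r) *
          (\<integral>\<^sup>+z. ennreal (1 - cos (\<theta> / B i * (fst z - snd z))) \<partial>(F \<Otimes>\<^sub>M F)))"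
      by (simp add: nn_integral_add nn_integral_cmult nn_integral_suminf P.emeasure_space_1 del: space_pair_measure)
    also have "\<dots> = ennreal ((B 0 / \<theta>) powr r) + ennreal \<kappa> * (\<Sum>i. ennreal (B i powr r) *
          ennreal (1 - (cmod (char F (\<theta> / B i)))\<^sup>2))"
      unfolding F.symmetrised_char
      by (subst nn_integral_eq_integral[OF int1]) (auto simp del: times_divide_eq_left)
    \<comment> \<open>Growth of the scales by 2^(1/p) against the decay 2^(-i) leaves the ratio
      2^(r/p) / 2, which is below 1.\<close>
    also have "\<dots> \<le> ennreal ((B 0 / \<theta>) powr r) + ennreal \<kappa> *
        (\<Sum>i. ennreal (C * B 0 powr r * (2 powr (r / p) / 2) ^ i))"
    proof (intro add_left_mono mult_left_mono suminf_le summableI)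
      fix i
      have "B i powr r \<le> (B 0 * (2 powr (1 / p)) ^ i) powr r"
        using Bgrow[of i] Bpos[of i] r by (intro powr_mono2) auto
      also have "\<dots> = B 0 powr r * (2 powr (r / p)) ^ i"
        using Bpos[of 0] by (simp add: powr_mult powr_powr powr_realpow[symmetric] mult_ac)
      finally have "B i powr r * (1 - (cmod (char F (\<theta> / B i)))\<^sup>2) \<le>
          B 0 powr r * (2 powr (r / p)) ^ i * (C / 2 ^ i)"
        using K[of i] F.cmod_char_le_1[of "\<theta> / B i"]
        by (intro mult_mono) (auto simp: power_le_one)
      then show "ennreal (B i powr r) * ennreal (1 - (cmod (char F (\<theta> / B i)))\<^sup>2) \<le>
          ennreal (C * B 0 powr r * (2 powr (r / p) / 2) ^ i)"
        by (subst ennreal_mult'[symmetric]) (auto intro!: ennreal_leI simp: power_divide mult_ac)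
    qed auto
    also have "\<dots> < \<infinity>"
    proof -
      have "2 powr (r / p) < 2 powr (1::real)" using p by (intro powr_less_mono) auto
      then have "summable (\<lambda>i. C * B 0 powr r * (2 powr (r / p) / 2) ^ i)"
        by (intro summable_mult summable_geometric) auto
      moreover have "C \<ge> 0"
        using K[of 0] F.cmod_char_le_1[of "\<theta> / B 0"] power_le_one[of "cmod (char F (\<theta> / B 0))" 2] by simp
      ultimately show ?thesis
        by (subst suminf_ennreal2) (auto simp: ennreal_mult_less_top)
    qed
    finally show ?thesis .
  qed
qed

lemma domain_of_attraction_moment:
  assumes F: "real_distribution F" and G: "stable_law \<alpha> G" "1 < \<alpha>"
    and attr: "in_domain_of_attraction F G" and r: "0 < r" "r < \<alpha>"
  shows "(\<integral>\<^sup>+x. ennreal (\<bar>x\<bar> powr r) \<partial>F) < \<infinity>"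
proof -
  interpret F: real_distribution F by fact
  obtain a b :: "nat \<Rightarrow> real" where a: "\<And>n. a n > 0" and conv: "weak_conv_m
      (\<lambda>n. distr (\<Pi>\<^sub>M i\<in>{..<n}. F) borel (\<lambda>y. ((\<Sum>i<n. y i) - b n) / a n)) G"
    using attr unfolding in_domain_of_attraction_def by blast
  show ?thesis
    by (intro F.finite_moment_if_symmetrised r(1) attraction_symmetrised_moment[OF F G(1) a conv r G(2)])
qed

section \<open>Analytic estimates\<close>

text \<open>For x \<le> 1, multiply 1 + x \<le> exp x by 1 - x + x^2, use (1 + x)(1 - x + x^2) = 1 +
  x^3 \<ge> 1, and then x^2 \<le> x^p. For x > 1, x^p \<ge> x and exp(-x) \<le> 1 suffice.\<close>

lemma exp_minus_le_powr:
  fixes x :: real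
  assumes x: "x \<ge> 0" and p: "1 \<le> p" "p \<le> 2"
  shows "exp (- x) \<le> 1 - x + x powr p"
proof (cases "x \<le> 1")
  case True
  have "(1 + x) * (1 - x + x\<^sup>2) = 1 + x ^ 3"
    by (simp add: algebra_simps power2_eq_square power3_eq_cube)
  then have "1 \<le> (1 + x) * (1 - x + x\<^sup>2)" using x by simp
  also have "\<dots> \<le> exp x * (1 - x + x\<^sup>2)"
    using x True by (intro mult_right_mono exp_ge_add_one_self) auto
  finally have "exp (- x) \<le> 1 - x + x\<^sup>2"
    by (simp add: exp_minus field_simps)
  also have "x\<^sup>2 \<le> x powr p"
    using powr_mono'[of p 2 x] x True p by (cases "x = 0") auto
  finally show ?thesis by simp
next
  case False
  then have "x powr 1 \<le> x powr p" using p by (intro powr_mono) auto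
  moreover have "x powr 1 = x" "exp (- x) \<le> 1" using x by auto
  ultimately show ?thesis using False by linarith
qed

lemma one_minus_power_le:
  fixes u :: real
  assumes u: "0 \<le> u" "u \<le> 1" and p: "1 \<le> p" "p \<le> 2"
  shows "(1 - u) ^ k \<le> 1 - u * real k + u powr p * real k powr p"
proof -
  have "(1 - u) ^ k \<le> exp (- u) ^ k"
    using u exp_ge_add_one_self[of "- u"] by (intro power_mono) auto
  also have "\<dots> = exp (- (u * real k))" by (simp add: exp_of_nat_mult[symmetric] mult.commute)
  also have "\<dots> \<le> 1 - u * real k + (u * real k) powr p"
    using u p by (intro exp_minus_le_powr) auto
  finally show ?thesis using u by (simp add: powr_mult)
qed

text \<open>Only a moment of order p is at hand, so the remainder is of order u^p instead of
  u^2.\<close>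

lemma (in prob_space) generating_function_le:
  fixes X :: "'a \<Rightarrow> nat"
  assumes [measurable]: "X \<in> measurable M (count_space UNIV)"
    and X: "integrable M (\<lambda>\<omega>. real (X \<omega>))" and Xp: "integrable M (\<lambda>\<omega>. real (X \<omega>) powr p)"
    and u: "0 \<le> u" "u \<le> 1" and p: "1 \<le> p" "p \<le> 2"
  shows "expectation (\<lambda>\<omega>. (1 - u) ^ X \<omega>) \<le>
    1 - u * expectation (\<lambda>\<omega>. real (X \<omega>)) + u powr p * expectation (\<lambda>\<omega>. real (X \<omega>) powr p)"
proof -
  have "integrable M (\<lambda>\<omega>. (1 - u) ^ X \<omega>)"
    using u by (intro integrable_const_bound[where B=1]) (auto simp: power_le_one)
  then have "expectation (\<lambda>\<omega>. (1 - u) ^ X \<omega>) \<le>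
      expectation (\<lambda>\<omega>. 1 - u * real (X \<omega>) + u powr p * real (X \<omega>) powr p)"
    using X Xp by (intro integral_mono one_minus_power_le u p) auto
  also have "\<dots> = 1 - u * expectation (\<lambda>\<omega>. real (X \<omega>)) + u powr p * expectation (\<lambda>\<omega>. real (X \<omega>) powr p)"
    using X Xp by (simp add: prob_space)
  finally show ?thesis .
qed

text \<open>Truncate at a level \<open>L\<close>: \<open>N \<le> N\<^bsup>1+\<delta>\<^esup> / L\<^sup>\<delta> + L \<cdot> 1\<^bsub>{N > 0}\<^esub>\<close>, and choose \<open>L\<close> such that the first
  term contributes at most half of the mean.\<close>

lemma (in prob_space) prob_pos_ge_mean_powr:
  fixes N :: "'a \<Rightarrow> nat"
  assumes [measurable]: "N \<in> measurable M (count_space UNIV)"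
    and N: "integrable M (\<lambda>\<omega>. real (N \<omega>))" and Np: "integrable M (\<lambda>\<omega>. real (N \<omega>) powr (1 + \<delta>))"
    and K: "expectation (\<lambda>\<omega>. real (N \<omega>) powr (1 + \<delta>)) \<le> K" "K > 0" and \<delta>: "\<delta> > 0"
    and m: "0 < m" "m \<le> expectation (\<lambda>\<omega>. real (N \<omega>))"
  shows "(1 / 2) * (1 / (2 * K)) powr (1 / \<delta>) * m powr (1 + 1 / \<delta>) \<le> prob {\<omega> \<in> space M. N \<omega> \<noteq> 0}"
proof -
  \<comment> \<open>L solves K / L^\<delta> = m/2. What remains is m/2 \<le> L P(N > 0), and L being
    of order m^(-1/\<delta>) produces the exponent 1 + 1/\<delta>.\<close>
  define L where "L = (2 * K / m) powr (1 / \<delta>)"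
  have L: "L > 0" "L powr \<delta> = 2 * K / m"
    using K m \<delta> by (auto simp: L_def powr_powr)
  have le: "real (N \<omega>) \<le> real (N \<omega>) powr (1 + \<delta>) / L powr \<delta> + L * indicator {\<omega> \<in> space M. N \<omega> \<noteq> 0} \<omega>"
    if "\<omega> \<in> space M" for \<omega>
  proof (cases "real (N \<omega>) \<le> L")
    case True
    then show ?thesis using that by (cases "N \<omega> = 0") (auto simp: add_increasing)
  next
    case False
    then have "(real (N \<omega>) / L) powr \<delta> \<ge> 1" using \<delta> L by (intro ge_one_powr_ge_zero) auto
    then have "real (N \<omega>) * 1 \<le> real (N \<omega>) * (real (N \<omega>) / L) powr \<delta>"
      by (intro mult_left_mono) auto
    also have "\<dots> = real (N \<omega>) powr (1 + \<delta>) / L powr \<delta>"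
      using L by (simp add: powr_divide powr_add)
    finally show ?thesis using L by (simp add: add_increasing2)
  qed
  have I: "integrable M (indicator {\<omega> \<in> space M. N \<omega> \<noteq> 0} :: 'a \<Rightarrow> real)"
    by (intro integrable_real_indicator) (auto simp: less_top[symmetric])
  have "m \<le> expectation (\<lambda>\<omega>. real (N \<omega>))" by fact
  also have "\<dots> \<le> expectation (\<lambda>\<omega>. real (N \<omega>) powr (1 + \<delta>) / L powr \<delta> + L * indicator {\<omega> \<in> space M. N \<omega> \<noteq> 0} \<omega>)"
    using N Np I by (intro integral_mono le Bochner_Integration.integrable_add integrable_mult_right integrable_divide)
  also have "\<dots> = expectation (\<lambda>\<omega>. real (N \<omega>) powr (1 + \<delta>)) / L powr \<delta> + L * prob {\<omega> \<in> space M. N \<omega> \<noteq> 0}"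
    using Np I by (subst Bochner_Integration.integral_add) (auto intro: integrable_mult_right simp del: integrable_indicator_iff)
  also have "expectation (\<lambda>\<omega>. real (N \<omega>) powr (1 + \<delta>)) / L powr \<delta> \<le> K / L powr \<delta>"
    using K by (intro divide_right_mono) auto
  also have "K / L powr \<delta> = m / 2" using L(2) K m by simp
  finally have "m / 2 / L \<le> prob {\<omega> \<in> space M. N \<omega> \<noteq> 0}"
    using L by (simp add: field_simps)
  also have "m / 2 / L = (1 / 2) * (1 / (2 * K)) powr (1 / \<delta>) * m powr (1 + 1 / \<delta>)"
    using K m by (simp add: L_def powr_add powr_divide)
  finally show ?thesis .
qed

section \<open>Doubly exponential sequences\<close>

text \<open>The antiderivative is -ln(-ln x), so the mass of an interval depends only on the ratio
  of the logarithms of its endpoints.\<close>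

lemma nn_integral_inverse_times_ln:
  fixes a b :: real
  assumes "0 < a" "a \<le> b" "b < 1"
  shows "(\<integral>\<^sup>+x\<in>{a..b}. ennreal (1 / (x * \<bar>ln x\<bar>)) \<partial>lborel) = ennreal (ln (ln a / ln b))"
proof -
  have "(\<integral>\<^sup>+x\<in>{a..b}. ennreal (1 / (x * \<bar>ln x\<bar>)) \<partial>lborel) = ennreal (- ln (- ln b) - - ln (- ln a))"
  proof (rule nn_integral_FTC_Icc)
    fix x assume x: "x \<in> {a..b}"
    then have "0 < x" "x < 1" using assms by auto
    then have "ln x < 0" by simp
    then show "DERIV (\<lambda>x. - ln (- ln x)) x :> 1 / (x * \<bar>ln x\<bar>)"
      using \<open>0 < x\<close> by (auto intro!: derivative_eq_intros simp: field_simps)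
    show "0 \<le> 1 / (x * \<bar>ln x\<bar>)" using \<open>0 < x\<close> by simp
  qed (use assms in auto)
  also have "- ln (- ln b) - - ln (- ln a) = ln (ln a / ln b)"
    using assms ln_div[of "- ln a" "- ln b"] by simp
  finally show ?thesis .
qed

text \<open>Consecutive points y^(q^n) have logarithms in ratio q, so each block between them has
  the same mass ln q under dx / (x |ln x|). On a block, g is at least its value at the left
  endpoint; hence ln q times the series is at most the integral.\<close>

lemma suminf_inverse_doubly_exponential:
  fixes g :: "real \<Rightarrow> ennreal"
  assumes mono: "\<And>x y. x \<le> y \<Longrightarrow> g x \<le> g y"
    and fin: "(\<integral>\<^sup>+x\<in>{0<..<\<epsilon>}. g x / ennreal (x * \<bar>ln x\<bar>) \<partial>lborel) < \<infinity>"
    and y: "0 < y" "y < \<epsilon>" "y < 1" and q: "q > 1"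
  shows "(\<Sum>n. g (y powr (q ^ Suc n))) < \<infinity>"
proof -
  define z where "z n = y powr (q ^ n)" for n
  have z: "0 < z n" "z n \<le> y" "z (Suc n) < z n" for n
    using y q powr_mono'[of 1 "q ^ n" y] by (auto simp: z_def one_le_power powr_less_mono')
  have "antimono z" using z(3) by (intro decseq_SucI) (auto intro: less_imp_le)
  then have dec: "m \<le> n \<Longrightarrow> z n \<le> z m" for m n by (auto simp: antimono_def)
  have lnz: "ln (z (Suc n)) / ln (z n) = q" for n
    using y q by (simp add: z_def)
  have disj: "disjoint_family (\<lambda>n. {z (Suc n)..<z n})"
  proof -
    have "{z (Suc m)..<z m} \<inter> {z (Suc n)..<z n} = {}" if "m < n" for m n
      using dec[of "Suc m" n] that by auto
    then show ?thesis unfolding disjoint_family_on_def by (metis Int_commute linorder_neqE_nat)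
  qed
  have "(\<Sum>n. g (z (Suc n)) * ennreal (ln q)) =
      (\<Sum>n. g (z (Suc n)) * (\<integral>\<^sup>+x\<in>{z (Suc n)..z n}. ennreal (1 / (x * \<bar>ln x\<bar>)) \<partial>lborel))"
    using z y by (subst nn_integral_inverse_times_ln)
      (auto simp: lnz intro: less_imp_le le_less_trans)
  also have "\<dots> = (\<Sum>n. \<integral>\<^sup>+x. g (z (Suc n)) * ennreal (1 / (x * \<bar>ln x\<bar>)) * indicator {z (Suc n)..<z n} x \<partial>lborel)"
  proof (intro suminf_cong)
    fix n
    \<comment> \<open>Dropping the right endpoint, a null set, makes the blocks disjoint.\<close>
    have "AE x in lborel. x \<noteq> z n" by (rule AE_lborel_singleton)
    then have "(\<integral>\<^sup>+x\<in>{z (Suc n)..z n}. ennreal (1 / (x * \<bar>ln x\<bar>)) \<partial>lborel) =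
      (\<integral>\<^sup>+x\<in>{z (Suc n)..<z n}. ennreal (1 / (x * \<bar>ln x\<bar>)) \<partial>lborel)"
      by (intro nn_integral_cong_AE) (auto split: split_indicator)
    then show "g (z (Suc n)) * (\<integral>\<^sup>+x\<in>{z (Suc n)..z n}. ennreal (1 / (x * \<bar>ln x\<bar>)) \<partial>lborel) =
      (\<integral>\<^sup>+x. g (z (Suc n)) * ennreal (1 / (x * \<bar>ln x\<bar>)) * indicator {z (Suc n)..<z n} x \<partial>lborel)"
      by (simp add: nn_integral_cmult[symmetric] mult.assoc)
  qed
  also have "\<dots> = (\<integral>\<^sup>+x. (\<Sum>n. g (z (Suc n)) * ennreal (1 / (x * \<bar>ln x\<bar>)) * indicator {z (Suc n)..<z n} x) \<partial>lborel)"
    by (rule nn_integral_suminf[symmetric]) measurable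
  also have "\<dots> \<le> (\<integral>\<^sup>+x\<in>{0<..<\<epsilon>}. g x / ennreal (x * \<bar>ln x\<bar>) \<partial>lborel)"
  proof (intro nn_integral_mono)
    fix x
    show "(\<Sum>n. g (z (Suc n)) * ennreal (1 / (x * \<bar>ln x\<bar>)) * indicator {z (Suc n)..<z n} x) \<le>
      g x / ennreal (x * \<bar>ln x\<bar>) * indicator {0<..<\<epsilon>} x"
    proof (cases "\<exists>n. x \<in> {z (Suc n)..<z n}")
      case True
      then obtain n where n: "x \<in> {z (Suc n)..<z n}" by blast
      then have x: "0 < x" "x < \<epsilon>" "x < 1" "z (Suc n) \<le> x"
        using z(1)[of "Suc n"] z(2)[of n] y by auto
      then have pos: "x * \<bar>ln x\<bar> > 0" by (simp add: mult_pos_neg)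
      have "(\<Sum>n. g (z (Suc n)) * ennreal (1 / (x * \<bar>ln x\<bar>)) * indicator {z (Suc n)..<z n} x) =
          g (z (Suc n)) * ennreal (1 / (x * \<bar>ln x\<bar>))"
        by (rule suminf_cmult_indicator[OF disj n])
      also have "\<dots> \<le> g x * ennreal (1 / (x * \<bar>ln x\<bar>))"
        by (intro mult_right_mono mono x) auto
      also have "\<dots> = g x / ennreal (x * \<bar>ln x\<bar>)"
        using pos by (simp add: divide_ennreal_def inverse_ennreal inverse_eq_divide)
      finally show ?thesis using x by simp
    next
      case False
      then have "(\<Sum>n. g (z (Suc n)) * ennreal (1 / (x * \<bar>ln x\<bar>)) * indicator {z (Suc n)..<z n} x) = 0"
        by (subst suminf_cong[where g="\<lambda>_. 0"]) (auto simp: indicator_def)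
      then show ?thesis by simp
    qed
  qed
  also have "\<dots> < \<infinity>" by fact
  finally have "(\<Sum>n. g (z (Suc n))) * ennreal (ln q) < \<infinity>" by simp
  then have "(\<Sum>n. g (z (Suc n))) < \<infinity>"
    using q by (auto simp: ennreal_mult_less_top less_top)
  then show ?thesis by (simp add: z_def)
qed

text \<open>With u = y^\<eta> the next value is u^q. The error C u^p has to be absorbed by the gain
  (1 - u) \<pi> u^q \<ge> \<pi> u^q / 2, where \<pi> \<ge> c y^\<kappa>; so y^(\<eta> p) must be
  small against y^(\<kappa> + \<eta> q).\<close>

lemma supersolution_parameters:
  fixes p c C \<kappa> :: real
  assumes p: "1 < p" "p \<le> 2" and c: "c > 0" and C: "C \<ge> 0" and \<kappa>: "\<kappa> > 0"
  shows "\<exists>q>1. \<exists>\<eta>>0. \<exists>y0>0. \<forall>y. 0 < y \<longrightarrow> y \<le> y0 \<longrightarrow> y powr \<eta> \<le> 1 / 2 \<and>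
    (\<forall>\<pi>. c * y powr \<kappa> \<le> \<pi> \<longrightarrow> \<pi> \<le> 1 \<longrightarrow>
      (1 - y powr \<eta> + C * (y powr \<eta>) powr p) * (1 - \<pi> * (y powr q) powr \<eta>) \<le> 1 - y powr \<eta>)"
proof -
  define q where "q = (1 + p) / 2"
  have q: "q > 1" "q < p" "p - q < 1" using p by (auto simp: q_def field_simps)
  \<comment> \<open>This makes \<eta> p = \<kappa> + \<eta> q + 1, which leaves one spare factor y
    to absorb the constants. As p - q < 1, also \<eta> \<ge> 1, hence y^\<eta> \<le> y.\<close>
  define \<eta> where "\<eta> = (\<kappa> + 1) / (p - q)"
  have \<eta>: "\<eta> \<ge> 1" "\<eta> * (p - q) = \<kappa> + 1" using q \<kappa> by (auto simp: \<eta>_def field_simps)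
  \<comment> \<open>The second bound ensures C y \<le> c/2; the summand 1 keeps the denominator
    positive when C = 0.\<close>
  define y0 where "y0 = min (1 / 2) (c / (2 * C + 1))"
  have y0: "y0 > 0" using c C by (auto simp: y0_def)
  have "y powr \<eta> \<le> 1 / 2 \<and>
    (\<forall>\<pi>. c * y powr \<kappa> \<le> \<pi> \<longrightarrow> \<pi> \<le> 1 \<longrightarrow>
      (1 - y powr \<eta> + C * (y powr \<eta>) powr p) * (1 - \<pi> * (y powr q) powr \<eta>) \<le> 1 - y powr \<eta>)"
    if y: "0 < y" "y \<le> y0" for y
  proof (intro conjI allI impI)
    have y1: "y \<le> 1 / 2" "y * (2 * C + 1) \<le> c" using y c C by (auto simp: y0_def field_simps)
    define u where "u = y powr \<eta>"
    have "u \<le> y powr 1" unfolding u_def using y y1 \<eta> by (intro powr_mono') auto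
    then have u: "0 < u" "u \<le> 1 / 2" using y y1 by (auto simp: u_def)
    then show "y powr \<eta> \<le> 1 / 2" by (simp add: u_def)
    fix \<pi> assume \<pi>: "c * y powr \<kappa> \<le> \<pi>" "\<pi> \<le> 1"
    define v where "v = (y powr q) powr \<eta>"
    define a where "a = \<pi> * v"
    have \<pi>0: "0 \<le> \<pi>" using \<pi>(1) c by (meson mult_nonneg_nonneg less_imp_le order_trans powr_ge_zero)
    have "y powr q \<le> 1" "0 \<le> y powr q" using y y1 q by (auto intro: powr_le1)
    then have v: "0 \<le> v" "v \<le> 1" unfolding v_def using \<eta> by (auto intro!: powr_le1)
    have a: "0 \<le> a" "a \<le> 1" using v \<pi>0 \<pi>(2) by (auto simp: a_def mult_le_one)
    have "C * u powr p = C * y powr (\<eta> * p)" by (simp add: u_def powr_powr)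
    also have "\<eta> * p = (\<kappa> + \<eta> * q) + 1" using \<eta>(2) by (simp add: algebra_simps)
    also have "C * y powr ((\<kappa> + \<eta> * q) + 1) = (C * y) * y powr (\<kappa> + \<eta> * q)"
      using y by (simp only: powr_add) simp
    also have "\<dots> \<le> (c / 2) * y powr (\<kappa> + \<eta> * q)"
      using y1 y by (intro mult_right_mono) (auto simp: algebra_simps)
    also have "\<dots> = (c * y powr \<kappa>) * v / 2"
      by (simp add: v_def powr_powr powr_add mult_ac)
    also have "\<dots> \<le> a / 2" using \<pi> v by (auto simp: a_def intro!: mult_right_mono)
    finally have *: "C * u powr p \<le> a / 2" .
    have "(1 - u + C * u powr p) * (1 - a) = (1 - u) - (1 - u) * a + C * u powr p * (1 - a)"
      by (simp add: algebra_simps)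
    also have "\<dots> \<le> (1 - u) - (1 / 2) * a + C * u powr p"
      using a C u by (intro add_mono diff_mono mult_right_mono mult_left_le) auto
    finally show "(1 - y powr \<eta> + C * (y powr \<eta>) powr p) * (1 - \<pi> * (y powr q) powr \<eta>) \<le> 1 - y powr \<eta>"
      using * by (simp add: u_def v_def a_def)
  qed
  moreover have "\<eta> > 0" using \<eta> by simp
  ultimately show ?thesis using q(1) y0 by blast
qed

section \<open>Point measures and family trees\<close>

text \<open>Since \<open>measure\<close> is 0 where \<open>emeasure\<close> is infinite, infinite
  counts are recorded as 0.\<close>

definition point_count :: "real measure \<Rightarrow> real set \<Rightarrow> nat" where
  "point_count \<nu> B = nat \<lfloor>measure \<nu> B\<rfloor>"

lemma point_measures_emeasure_cases:
  assumes "\<nu> \<in> point_measures" "B \<in> sets halfline"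
  obtains "emeasure \<nu> B = \<infinity>" "point_count \<nu> B = 0" | k where "emeasure \<nu> B = of_nat k" "point_count \<nu> B = k"
proof -
  obtain e where e: "emeasure \<nu> B = ennreal_of_enat e"
    using assms unfolding point_measures_def by auto
  show ?thesis
  proof (cases e)
    case (enat k)
    then have "emeasure \<nu> B = of_nat k" using e by simp
    moreover from this have "point_count \<nu> B = k"
      by (simp add: point_count_def measure_def enn2real_of_nat)
    ultimately show ?thesis using that by blast
  next
    case infinity
    then have "emeasure \<nu> B = \<infinity>" using e by simp
    then show ?thesis using that by (simp add: point_count_def measure_def)
  qed
qed

lemma of_nat_point_count_le:
  "\<nu> \<in> point_measures \<Longrightarrow> B \<in> sets halfline \<Longrightarrow> of_nat (point_count \<nu> B) \<le> emeasure \<nu> B"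
  by (erule (1) point_measures_emeasure_cases) auto

lemma emeasure_eq_point_count:
  "\<nu> \<in> point_measures \<Longrightarrow> B \<in> sets halfline \<Longrightarrow> emeasure \<nu> B < \<infinity> \<Longrightarrow>
    emeasure \<nu> B = of_nat (point_count \<nu> B)"
  by (erule (1) point_measures_emeasure_cases) auto

lemma sets_halfline_iff: "B \<in> sets halfline \<longleftrightarrow> B \<in> sets borel \<and> B \<subseteq> {0..}"
  unfolding halfline_def by (auto simp: sets_restrict_space_iff)

lemma measurable_emeasure_interval [measurable]:
  "(\<lambda>\<nu>. emeasure \<nu> {0..t}) \<in> borel_measurable point_measure_algebra"
  "(\<lambda>\<nu>. emeasure \<nu> {0<..t}) \<in> borel_measurable point_measure_algebra"
  "(\<lambda>\<nu>. emeasure \<nu> {0}) \<in> borel_measurable point_measure_algebra"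
  by (auto intro!: measurable_emeasure_point_measure_algebra simp: sets_halfline_iff)

lemma measurable_point_count:
  assumes "B \<in> sets halfline"
  shows "(\<lambda>\<nu>. point_count \<nu> B) \<in> measurable point_measure_algebra (count_space UNIV)"
proof -
  note [measurable] = measurable_emeasure_point_measure_algebra[OF assms]
  show ?thesis unfolding point_count_def measure_def by measurable
qed

text \<open>Mass of \<open>{0..t}\<close> is monotone in t and the inequality \<open>< y\<close> is
  strict, so the witness t may be increased to a rational one and the union becomes
  countable.\<close>

lemma measurable_nth_point [measurable]:
  "(\<lambda>\<nu>. nth_point \<nu> j) \<in> borel_measurable point_measure_algebra"
proof (rule borel_measurableI_less)
  fix y
  have "nth_point \<nu> j < y \<longleftrightarrow>
      (\<exists>q::rat. 0 \<le> q \<and> ennreal (of_rat q) < y \<and> of_nat j \<le> emeasure \<nu> {0..of_rat q})"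
    if \<nu>: "\<nu> \<in> space point_measure_algebra" for \<nu>
  proof
    assume "nth_point \<nu> j < y"
    then obtain t where t: "0 \<le> t" "of_nat j \<le> emeasure \<nu> {0..t}" "ennreal t < y"
      by (auto simp: nth_point_def INF_less_iff)
    obtain q where q: "t < of_rat q" "ennreal (of_rat q) < y"
    proof (cases y)
      case (real r)
      then have "t < r" using t by (simp add: ennreal_less_iff)
      then obtain q where "t < of_rat q" "of_rat q < r" using of_rat_dense by blast
      then show ?thesis using that[of q] real t(1) ennreal_lessI[of r "of_rat q"] by simp
    next
      case top
      then show ?thesis using of_rat_dense[of t "t + 1"] that by auto
    qed
    have "{0..of_rat q} \<in> sets \<nu>"
      using \<nu> by (auto simp: space_point_measure_algebra point_measures_def sets_halfline_iff)
    then have "emeasure \<nu> {0..t} \<le> emeasure \<nu> {0..of_rat q}"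
      using q by (intro emeasure_mono) auto
    then show "\<exists>q::rat. 0 \<le> q \<and> ennreal (of_rat q) < y \<and> of_nat j \<le> emeasure \<nu> {0..of_rat q}"
      using q t by (intro exI[of _ q]) (auto simp: zero_le_of_rat_iff[symmetric, where 'a=real] simp del: zero_le_of_rat_iff)
  next
    assume "\<exists>q::rat. 0 \<le> q \<and> ennreal (of_rat q) < y \<and> of_nat j \<le> emeasure \<nu> {0..of_rat q}"
    then obtain q :: rat where "0 \<le> q" "ennreal (of_rat q) < y" "of_nat j \<le> emeasure \<nu> {0..of_rat q}"
      by blast
    then show "nth_point \<nu> j < y"
      unfolding nth_point_def INF_less_iff by (intro bexI[of _ "of_rat q"]) auto
  qed
  then have "{\<nu> \<in> space point_measure_algebra. nth_point \<nu> j < y} =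
     {\<nu> \<in> space point_measure_algebra.
      (\<exists>q::rat. 0 \<le> q \<and> ennreal (of_rat q) < y \<and> of_nat j \<le> emeasure \<nu> {0..of_rat q})}"
    by blast
  also have "\<dots> \<in> sets point_measure_algebra" by measurable
  finally show "{\<nu> \<in> space point_measure_algebra. nth_point \<nu> j < y} \<in> sets point_measure_algebra" .
qed

section \<open>Birth times, generations and explosion\<close>

lemma labels_simps [simp]: "[] \<in> labels" "j # u \<in> labels \<longleftrightarrow> 1 \<le> j \<and> u \<in> labels"
    "u @ v \<in> labels \<longleftrightarrow> u \<in> labels \<and> v \<in> labels"
  by (auto simp: labels_def)

text \<open>The definition splits off the last ancestor-to-child step; this splits off the first
  one. As labels are read from right to left, \<open>v @ [j]\<close> is the descendant v in the
  subtree of the root's child j.\<close>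

lemma birth_time_append:
  "birth_time \<nu> (v @ [j]) = nth_point (\<nu> []) j + birth_time (\<lambda>w. \<nu> (w @ [j])) v"
  by (induction v) (auto simp: add.assoc)

lemma birth_time_cong:
  "(\<And>w. w \<in> labels \<Longrightarrow> \<nu> w = \<nu>' w) \<Longrightarrow> u \<in> labels \<Longrightarrow> birth_time \<nu> u = birth_time \<nu>' u"
  by (induction u) auto

lemma measurable_birth_time:
  assumes "\<And>w. w \<in> labels \<Longrightarrow> f w \<in> measurable N point_measure_algebra" and "u \<in> labels"
  shows "(\<lambda>x. birth_time (\<lambda>w. f w x) u) \<in> borel_measurable N"
  using assms(2)
proof (induction u)
  case (Cons j u)
  then have [measurable]: "f u \<in> measurable N point_measure_algebra"
    "(\<lambda>x. birth_time (\<lambda>w. f w x) u) \<in> borel_measurable N"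
    using assms(1) by auto
  show ?case by simp
qed simp

definition extinct_by :: "nat \<Rightarrow> real \<Rightarrow> (nat list \<Rightarrow> real measure) \<Rightarrow> bool" where
  "extinct_by n t \<nu> \<longleftrightarrow> (\<forall>u\<in>labels. length u = n \<longrightarrow> ennreal t < birth_time \<nu> u)"

lemma extinct_by_cong:
  "(\<And>w. w \<in> labels \<Longrightarrow> \<nu> w = \<nu>' w) \<Longrightarrow> extinct_by n t \<nu> = extinct_by n t \<nu>'"
  unfolding extinct_by_def using birth_time_cong[of \<nu> \<nu>'] by (intro ball_cong refl) simp

lemma sets_extinct_by:
  assumes "\<And>w. w \<in> labels \<Longrightarrow> f w \<in> measurable N point_measure_algebra"
  shows "{x \<in> space N. extinct_by n t (\<lambda>w. f w x)} \<in> sets N"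
proof -
  have "{x \<in> space N. ennreal t < birth_time (\<lambda>w. f w x) u} \<in> sets N" if "u \<in> labels" for u
    using measurable_birth_time[OF assms that] by measurable
  then have "{x \<in> space N. u \<in> labels \<longrightarrow> length u = n \<longrightarrow> ennreal t < birth_time (\<lambda>w. f w x) u} \<in> sets N" for u
    by (cases "u \<in> labels \<and> length u = n") auto
  then show ?thesis unfolding extinct_by_def Ball_def
    by (rule sets.sets_Collect_countable_All)
qed

text \<open>Only countable quantifiers remain, as measurability requires: monotonicity in time
  allows integer times, and a set of labels is infinite iff its codes are unbounded.\<close>

lemma explosion_time_finite_iff:
  "explosion_time \<nu> < \<infinity> \<longleftrightarrow> (\<exists>k::nat. \<forall>l. \<exists>u. l \<le> to_nat u \<and> u \<in> labels \<and> birth_time \<nu> u \<le> ennreal (real k))"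
proof -
  have inf: "population \<nu> t = \<infinity> \<longleftrightarrow> infinite {u \<in> labels. birth_time \<nu> u \<le> ennreal t}" for t
    by (simp add: population_def emeasure_count_space)
  have "explosion_time \<nu> < \<infinity> \<longleftrightarrow> (\<exists>t\<ge>0. population \<nu> t = \<infinity>)"
    by (auto simp: explosion_time_def INF_less_iff)
  also have "\<dots> \<longleftrightarrow> (\<exists>k::nat. population \<nu> (real k) = \<infinity>)"
  proof
    assume "\<exists>t\<ge>0. population \<nu> t = \<infinity>"
    then obtain t where t: "infinite {u \<in> labels. birth_time \<nu> u \<le> ennreal t}" unfolding inf by blast
    obtain k :: nat where "t \<le> real k" using real_arch_simple by blast
    then have "{u \<in> labels. birth_time \<nu> u \<le> ennreal t} \<subseteq> {u \<in> labels. birth_time \<nu> u \<le> ennreal (real k)}"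
      by (auto intro: order_trans ennreal_leI)
    then show "\<exists>k::nat. population \<nu> (real k) = \<infinity>"
      using t infinite_super unfolding inf by blast
  next
    assume "\<exists>k::nat. population \<nu> (real k) = \<infinity>"
    then obtain k :: nat where "population \<nu> (real k) = \<infinity>" by blast
    then show "\<exists>t\<ge>0. population \<nu> t = \<infinity>" by (intro exI[of _ "real k"]) simp
  qed
  also have "\<dots> \<longleftrightarrow> (\<exists>k::nat. \<forall>l. \<exists>u. l \<le> to_nat u \<and> u \<in> labels \<and> birth_time \<nu> u \<le> ennreal (real k))"
  proof -
    have "infinite A \<longleftrightarrow> (\<forall>l. \<exists>u. l \<le> to_nat u \<and> u \<in> A)" for A :: "nat list set"
    proof -
      have "infinite A \<longleftrightarrow> infinite (to_nat ` A)"
        by (simp add: finite_image_iff inj_on_subset[OF inj_to_nat])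
      also have "\<dots> \<longleftrightarrow> (\<forall>l. \<exists>u. l \<le> to_nat u \<and> u \<in> A)"
        unfolding infinite_nat_iff_unbounded_le by blast
      finally show ?thesis .
    qed
    then show ?thesis unfolding inf by simp
  qed
  finally show ?thesis .
qed

lemma sets_explosion_time_finite:
  assumes "\<And>w. w \<in> labels \<Longrightarrow> f w \<in> measurable N point_measure_algebra"
  shows "{x \<in> space N. explosion_time (\<lambda>w. f w x) < \<infinity>} \<in> sets N"
proof -
  have "{x \<in> space N. birth_time (\<lambda>w. f w x) u \<le> ennreal t} \<in> sets N" if "u \<in> labels" for u t
    using measurable_birth_time[OF assms that] by measurable
  then have "{x \<in> space N. l \<le> to_nat u \<and> u \<in> labels \<and> birth_time (\<lambda>w. f w x) u \<le> ennreal t} \<in> sets N" for u l t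
    by (cases "l \<le> to_nat u \<and> u \<in> labels") auto
  then show ?thesis unfolding explosion_time_finite_iff
    by (rule sets.sets_Collect_countable_Ex[OF sets.sets_Collect_countable_All[OF sets.sets_Collect_countable_Ex]])
qed

text \<open>One label of each length is born by time t, so infinitely many are. The maximum with 0
  is harmless because \<open>ennreal\<close> sends negative t to 0.\<close>

lemma explosion_if_never_extinct:
  assumes "\<And>n. \<not> extinct_by n t \<nu>"
  shows "explosion_time \<nu> < \<infinity>"
proof -
  let ?A = "{u \<in> labels. birth_time \<nu> u \<le> ennreal (max 0 t)}"
  have "n \<in> length ` ?A" for n
  proof -
    obtain u where u: "u \<in> labels" "length u = n" "birth_time \<nu> u \<le> ennreal t"
      using assms[of n] unfolding extinct_by_def by (auto simp: not_less)
    from u(3) have "birth_time \<nu> u \<le> ennreal (max 0 t)"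
      by (rule order_trans) (simp add: ennreal_leI)
    then show ?thesis using u by auto
  qed
  then have "length ` ?A = UNIV" by blast
  then have "infinite ?A" using finite_imageI[of ?A length] by auto
  then have "population \<nu> (max 0 t) = \<infinity>" by (simp add: population_def emeasure_count_space)
  then have "explosion_time \<nu> \<le> ennreal (max 0 t)"
    unfolding explosion_time_def by (intro INF_lower) auto
  then show ?thesis by (simp add: le_less_trans)
qed

text \<open>The points at 0 are the births of the first children, and a further point in (0,h] makes
  the next child appear by time h. Their subtrees inherit the emptiness, with the time that is
  left.\<close>

lemma extinct_by_Suc:
  assumes \<nu>: "\<nu> [] \<in> point_measures" and ext: "extinct_by (Suc n) t \<nu>" and t: "0 \<le> h" "h \<le> t"
  shows "j \<in> {1..point_count (\<nu> []) {0}} \<Longrightarrow> extinct_by n t (\<lambda>w. \<nu> (w @ [j]))"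
    and "emeasure (\<nu> []) {0<..h} \<noteq> 0 \<Longrightarrow>
      extinct_by n (t - h) (\<lambda>w. \<nu> (w @ [Suc (point_count (\<nu> []) {0})]))"
proof -
  have s: "sets (\<nu> []) = sets halfline" using \<nu> by (simp add: point_measures_def)
  \<comment> \<open>The delay d is 0 for the children born at time 0 and h for the extra
    child.\<close>
  have step: "extinct_by n (t - d) (\<lambda>w. \<nu> (w @ [j]))"
    if d: "0 \<le> d" "d \<le> t" "nth_point (\<nu> []) j \<le> ennreal d" "1 \<le> j" for d j
    unfolding extinct_by_def
  proof (intro ballI impI)
    fix u assume u: "u \<in> labels" "length u = n"
    then have "ennreal t < nth_point (\<nu> []) j + birth_time (\<lambda>w. \<nu> (w @ [j])) u"
      using ext d(4) unfolding extinct_by_def birth_time_append[symmetric] by auto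
    also have "\<dots> \<le> ennreal d + birth_time (\<lambda>w. \<nu> (w @ [j])) u"
      using d by (intro add_right_mono)
    finally show "ennreal (t - d) < birth_time (\<lambda>w. \<nu> (w @ [j])) u"
      using d by (cases "birth_time (\<lambda>w. \<nu> (w @ [j])) u")
        (auto simp: ennreal_plus[symmetric] ennreal_less_iff simp del: ennreal_plus)
  qed
  have z: "{0} \<in> sets halfline" by (simp add: sets_halfline_iff)
  show "extinct_by n t (\<lambda>w. \<nu> (w @ [j]))" if j: "j \<in> {1..point_count (\<nu> []) {0}}"
  proof -
    have "of_nat j \<le> (of_nat (point_count (\<nu> []) {0}) :: ennreal)" using j by simp
    also have "\<dots> \<le> emeasure (\<nu> []) {0}" by (rule of_nat_point_count_le[OF \<nu> z])
    finally have "nth_point (\<nu> []) j \<le> ennreal 0"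
      unfolding nth_point_def by (intro INF_lower) auto
    then show ?thesis using step[of 0 j] t j by auto
  qed
  assume pos: "emeasure (\<nu> []) {0<..h} \<noteq> 0"
  have p: "{0<..h} \<in> sets halfline" by (auto simp: sets_halfline_iff)
  have one: "1 \<le> emeasure (\<nu> []) {0<..h}"
    using \<nu> p
  proof (rule point_measures_emeasure_cases)
    fix k assume k: "emeasure (\<nu> []) {0<..h} = of_nat k"
    then have "1 \<le> k" using pos by (cases k) auto
    then have "(of_nat 1 :: ennreal) \<le> of_nat k" by (rule of_nat_mono)
    then show ?thesis by (simp add: k)
  qed simp
  \<comment> \<open>Only a lower bound for the mass at 0 enters, so an infinite mass, counted as 0,
    is covered too.\<close>
  have "of_nat (Suc (point_count (\<nu> []) {0})) \<le> emeasure (\<nu> []) {0} + emeasure (\<nu> []) {0<..h}"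
    using add_mono[OF of_nat_point_count_le[OF \<nu> z] one] by (simp add: add.commute)
  also have "\<dots> = emeasure (\<nu> []) ({0} \<union> {0<..h})"
    using s z p by (intro plus_emeasure) auto
  also have "{0} \<union> {0<..h} = {0..h}" using t by auto
  finally have "nth_point (\<nu> []) (Suc (point_count (\<nu> []) {0})) \<le> ennreal h"
    unfolding nth_point_def using t by (intro INF_lower) auto
  then show "extinct_by n (t - h) (\<lambda>w. \<nu> (w @ [Suc (point_count (\<nu> []) {0})]))"
    using step t by simp
qed

section \<open>Extinction probabilities\<close>

text \<open>Fixing the common law Q instead of a process makes the notion stable under passing to
  subtrees, as the induction on generations requires.\<close>

definition iid_family :: "'b measure \<Rightarrow> (nat list \<Rightarrow> 'b \<Rightarrow> real measure) \<Rightarrow> real measure measure \<Rightarrow> bool" where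
  "iid_family P \<Xi> Q \<longleftrightarrow> prob_space.indep_vars P (\<lambda>_. point_measure_algebra) \<Xi> labels \<and>
    (\<forall>u\<in>labels. distr P point_measure_algebra (\<Xi> u) = Q)"

context prob_space
begin

lemma iid_family_measurable:
  "iid_family M \<Xi> Q \<Longrightarrow> u \<in> labels \<Longrightarrow> \<Xi> u \<in> measurable M point_measure_algebra"
  by (auto simp: iid_family_def indep_vars_def)

lemma iid_family_subtree:
  assumes "iid_family M \<Xi> Q" "1 \<le> j"
  shows "iid_family M (\<lambda>w. \<Xi> (w @ [j])) Q"
proof -
  let ?f = "\<lambda>w. w @ [j]"
  have I: "indep_vars (\<lambda>_. point_measure_algebra) \<Xi> labels"
    and d: "\<And>u. u \<in> labels \<Longrightarrow> distr M point_measure_algebra (\<Xi> u) = Q"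
    using assms(1) unfolding iid_family_def by blast+
  have "indep_vars (\<lambda>w. \<Pi>\<^sub>M i\<in>{?f w}. point_measure_algebra) (\<lambda>w \<omega>. restrict (\<lambda>i. \<Xi> i \<omega>) {?f w}) labels"
    using assms(2) by (intro indep_vars_restrict[OF I]) (auto simp: disjoint_family_on_def)
  then have "indep_vars (\<lambda>_. point_measure_algebra) (\<lambda>w \<omega>. restrict (\<lambda>i. \<Xi> i \<omega>) {?f w} (?f w)) labels"
    by (rule indep_vars_compose2) (auto intro: measurable_component_singleton)
  then have "indep_vars (\<lambda>_. point_measure_algebra) (\<lambda>w. \<Xi> (?f w)) labels"
    by (simp cong: indep_vars_cong)
  moreover have "distr M point_measure_algebra (\<Xi> (w @ [j])) = Q" if "w \<in> labels" for w
    using that assms(2) by (intro d) simp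
  ultimately show ?thesis unfolding iid_family_def comp_def by blast
qed

text \<open>The root and the subtrees of different children use disjoint blocks of labels, so events
  that depend on different blocks are independent.\<close>

lemma prob_root_and_subtrees:
  assumes iid: "iid_family M \<Xi> Q" and A: "A \<in> sets point_measure_algebra"
  shows "prob {\<omega> \<in> space M. \<Xi> [] \<omega> \<in> A \<and> (\<forall>j\<in>{1..k}. extinct_by n (t j) (\<lambda>w. \<Xi> (w @ [j]) \<omega>))} =
    measure Q A * (\<Prod>j\<in>{1..k}. prob {\<omega> \<in> space M. extinct_by n (t j) (\<lambda>w. \<Xi> (w @ [j]) \<omega>)})"
proof -
  note m = iid_family_measurable[OF iid]
  \<comment> \<open>Children are numbered from 1, which leaves index 0 for the block of the
    root.\<close>
  define K where "K j = (if j = 0 then {[]} else (\<lambda>w. w @ [j]) ` labels)" for j :: nat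
  define Y where "Y j \<omega> = restrict (\<lambda>i. \<Xi> i \<omega>) (K j)" for j \<omega>
  define S where "S j = (\<Pi>\<^sub>M i\<in>K j. point_measure_algebra)" for j
  define B where "B j = (if j = 0 then {x \<in> space (S 0). x [] \<in> A}
      else {x \<in> space (S j). extinct_by n (t j) (\<lambda>w. x (w @ [j]))})" for j
  have K: "K j \<subseteq> labels" for j by (auto simp: K_def)
  have "disjoint_family_on K {0..k}"
    by (auto simp: disjoint_family_on_def K_def)
  then have ind: "indep_vars S Y {0..k}"
    unfolding S_def Y_def using iid K
    by (intro indep_vars_restrict[of _ _ labels]) (auto simp: iid_family_def)
  have Ym: "Y j \<in> measurable M (S j)" for j
    unfolding Y_def S_def using K m by (intro measurable_restrict) auto
  have Bm: "B j \<in> sets (S j)" for j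
  proof (cases "j = 0")
    case True
    have [measurable]: "(\<lambda>x. x []) \<in> measurable (S 0) point_measure_algebra"
      unfolding S_def by (rule measurable_component_singleton) (simp add: K_def)
    show ?thesis unfolding B_def using True A by simp measurable
  next
    case False
    have "{x \<in> space (S j). extinct_by n (t j) (\<lambda>w. x (w @ [j]))} \<in> sets (S j)"
      unfolding S_def using False
      by (intro sets_extinct_by measurable_component_singleton) (auto simp: K_def)
    then show ?thesis using False by (simp add: B_def)
  qed
  have pre: "Y 0 -` B 0 \<inter> space M = {\<omega> \<in> space M. \<Xi> [] \<omega> \<in> A}"
    using measurable_space[OF Ym[of 0]] by (fastforce simp: B_def Y_def K_def)
  have prej: "Y j -` B j \<inter> space M = {\<omega> \<in> space M. extinct_by n (t j) (\<lambda>w. \<Xi> (w @ [j]) \<omega>)}" if "j \<in> {1..k}" for j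
  proof -
    have "extinct_by n (t j) (\<lambda>w. Y j \<omega> (w @ [j])) = extinct_by n (t j) (\<lambda>w. \<Xi> (w @ [j]) \<omega>)" for \<omega>
      using that by (intro extinct_by_cong) (auto simp: Y_def K_def)
    then show ?thesis
      using that measurable_space[OF Ym[of j]] by (auto simp: B_def)
  qed
  have s: "{0..k} = insert 0 {1..k}" by auto
  have "{\<omega> \<in> space M. \<Xi> [] \<omega> \<in> A \<and> (\<forall>j\<in>{1..k}. extinct_by n (t j) (\<lambda>w. \<Xi> (w @ [j]) \<omega>))} =
      (\<Inter>j\<in>{0..k}. Y j -` B j \<inter> space M)"
    unfolding s using pre prej by auto
  also have "prob \<dots> = (\<Prod>j\<in>{0..k}. prob (Y j -` B j \<inter> space M))"
    using Bm by (intro indep_varsD[OF ind]) auto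
  also have "\<dots> = prob {\<omega> \<in> space M. \<Xi> [] \<omega> \<in> A} *
      (\<Prod>j\<in>{1..k}. prob {\<omega> \<in> space M. extinct_by n (t j) (\<lambda>w. \<Xi> (w @ [j]) \<omega>)})"
    unfolding s using pre prej by simp
  also have "prob {\<omega> \<in> space M. \<Xi> [] \<omega> \<in> A} = measure Q A"
  proof -
    have "Q = distr M point_measure_algebra (\<Xi> [])" using iid by (simp add: iid_family_def)
    then show ?thesis using m[of "[]"] A by (simp add: measure_distr vimage_def Int_def conj_commute)
  qed
  finally show ?thesis .
qed

end

section \<open>The recursion for extinction probabilities\<close>

lemma point_count_zero_sums:
  assumes Q: "prob_space Q" "sets Q = sets point_measure_algebra" and x: "0 \<le> x" "x \<le> 1"
  shows "(\<lambda>m. measure Q {\<nu> \<in> space point_measure_algebra. point_count \<nu> {0} = m} * x ^ m)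
    sums (\<integral>\<nu>. x ^ point_count \<nu> {0} \<partial>Q)"
proof -
  interpret Q: prob_space Q by fact
  have [measurable]: "(\<lambda>\<nu>. point_count \<nu> {0}) \<in> measurable Q (count_space UNIV)"
    using measurable_point_count[of "{0}"] Q(2) by (simp add: sets_halfline_iff cong: measurable_cong_sets)
  define D where "D m = {\<nu> \<in> space Q. point_count \<nu> {0} = m}" for m
  have D[measurable]: "D m \<in> sets Q" for m unfolding D_def by measurable
  have sp: "space Q = space point_measure_algebra" using Q(2) by (rule sets_eq_imp_space_eq)
  have "(\<lambda>m. measure Q (D m)) sums measure Q (\<Union>m. D m)"
    by (intro Q.finite_measure_UNION) (auto simp: D_def disjoint_family_on_def)
  then have sD: "summable (\<lambda>m. measure Q (D m))" by (rule sums_summable)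
  let ?f = "\<lambda>m \<nu>. x ^ m * indicator (D m) \<nu> :: real"
  have single: "(\<lambda>m. ?f m \<nu>) sums x ^ point_count \<nu> {0}" if "\<nu> \<in> space Q" for \<nu>
  proof -
    have "(\<lambda>m. ?f m \<nu>) = (\<lambda>m. if m = point_count \<nu> {0} then x ^ m else 0)"
      using that by (auto simp: D_def indicator_def)
    then show ?thesis using sums_single[of "point_count \<nu> {0}" "\<lambda>m. x ^ m"] by simp
  qed
  have i: "integrable Q (?f m)" for m
    by (intro integrable_mult_right integrable_real_indicator) (auto simp: less_top[symmetric])
  have "(\<lambda>m. \<integral>\<nu>. ?f m \<nu> \<partial>Q) sums (\<integral>\<nu>. (\<Sum>m. ?f m \<nu>) \<partial>Q)"
  proof (rule sums_integral[OF i])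
    have nf: "norm (?f m \<nu>) = ?f m \<nu>" for m \<nu> using x by simp
    show "AE \<nu> in Q. summable (\<lambda>m. norm (?f m \<nu>))"
      unfolding nf using single by (auto intro: sums_summable)
    show "summable (\<lambda>m. \<integral>\<nu>. norm (?f m \<nu>) \<partial>Q)"
      unfolding nf using x by (intro summable_comparison_test'[OF sD])
        (auto intro!: mult_left_le_one_le simp: power_le_one)
  qed
  also have "(\<integral>\<nu>. (\<Sum>m. ?f m \<nu>) \<partial>Q) = (\<integral>\<nu>. x ^ point_count \<nu> {0} \<partial>Q)"
    using single by (intro Bochner_Integration.integral_cong) (auto simp: sums_unique[symmetric])
  also have "(\<lambda>m. \<integral>\<nu>. ?f m \<nu> \<partial>Q) = (\<lambda>m. measure Q (D m) * x ^ m)"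
    by (simp add: sets.Int_space_eq2[OF D] mult.commute)
  finally show ?thesis by (simp only: D_def sp)
qed

context prob_space
begin

text \<open>Given k births at time 0, k subtrees must fail if (0,h] has no birth, and k + 1 if it
  has one. By \<open>ind\<close> the two cases contribute P(X = k) x^k ((1 - \<pi>) + \<pi> y);
  summing over k yields the generating function at x.\<close>

lemma prob_extinct_by_Suc_le:
  assumes iid: "iid_family M \<Xi> Q" and h: "0 \<le> h" "h \<le> t"
    and x: "0 \<le> x" "x \<le> 1" and y: "0 \<le> y" "y \<le> 1"
    and sub: "\<And>j. 1 \<le> j \<Longrightarrow> prob {\<omega> \<in> space M. extinct_by n t (\<lambda>w. \<Xi> (w @ [j]) \<omega>)} \<le> x"
      "\<And>j. 1 \<le> j \<Longrightarrow> prob {\<omega> \<in> space M. extinct_by n (t - h) (\<lambda>w. \<Xi> (w @ [j]) \<omega>)} \<le> y"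
    and ind: "\<And>m. measure Q {\<nu> \<in> space point_measure_algebra. point_count \<nu> {0} = m \<and> emeasure \<nu> {0<..h} \<noteq> 0} =
      measure Q {\<nu> \<in> space point_measure_algebra. point_count \<nu> {0} = m} * \<pi>"
  shows "prob {\<omega> \<in> space M. extinct_by (Suc n) t (\<lambda>w. \<Xi> w \<omega>)} \<le>
    (\<integral>\<nu>. x ^ point_count \<nu> {0} \<partial>Q) * (1 - \<pi> * (1 - y))"
proof -
  note m = iid_family_measurable[OF iid]
  have Q: "Q = distr M point_measure_algebra (\<Xi> [])" using iid by (simp add: iid_family_def)
  have m0 [measurable]: "\<Xi> [] \<in> measurable M point_measure_algebra" using m by simp
  interpret Q: prob_space Q unfolding Q by (rule prob_space_distr) simp
  have sQ: "sets Q = sets point_measure_algebra" by (simp add: Q)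
  have [measurable]: "(\<lambda>\<nu>. point_count \<nu> {0}) \<in> measurable point_measure_algebra (count_space UNIV)"
    by (rule measurable_point_count) (simp add: sets_halfline_iff)
  define D where "D k = {\<nu> \<in> space point_measure_algebra. point_count \<nu> {0} = k}" for k
  define D1 where "D1 k = {\<nu> \<in> space point_measure_algebra. point_count \<nu> {0} = k \<and> emeasure \<nu> {0<..h} = 0}" for k
  define D2 where "D2 k = {\<nu> \<in> space point_measure_algebra. point_count \<nu> {0} = k \<and> emeasure \<nu> {0<..h} \<noteq> 0}" for k
  have [measurable]: "D k \<in> sets point_measure_algebra" "D1 k \<in> sets point_measure_algebra"
      "D2 k \<in> sets point_measure_algebra" for k
    unfolding D_def D1_def D2_def by measurable
  define E where "E = {\<omega> \<in> space M. extinct_by (Suc n) t (\<lambda>w. \<Xi> w \<omega>)}"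
  have [measurable]: "E \<in> events" unfolding E_def using m by (rule sets_extinct_by)
  define W where "W k = E \<inter> {\<omega> \<in> space M. \<Xi> [] \<omega> \<in> D k}" for k
  have [measurable]: "W k \<in> events" for k unfolding W_def by measurable
  have sp: "\<omega> \<in> space M \<Longrightarrow> \<Xi> [] \<omega> \<in> space point_measure_algebra" for \<omega>
    using measurable_space[OF m0] .
  have "(\<lambda>k. prob (W k)) sums prob (\<Union>k. W k)"
    by (intro finite_measure_UNION) (auto simp: W_def D_def disjoint_family_on_def)
  also have "(\<Union>k. W k) = E" using sp by (auto simp: W_def D_def E_def)
  finally have sumE: "(\<lambda>k. prob (W k)) sums prob E" .
  have Wle: "prob (W k) \<le> measure Q (D k) * x ^ k * (1 - \<pi> * (1 - y))" for k
  proof -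
    \<comment> \<open>Child k + 1 is the extra one, to which only time t - h is guaranteed.\<close>
    define s where "s j = (if j = Suc k then t - h else t)" for j
    define U1 where "U1 = {\<omega> \<in> space M. \<Xi> [] \<omega> \<in> D1 k \<and> (\<forall>j\<in>{1..k}. extinct_by n t (\<lambda>w. \<Xi> (w @ [j]) \<omega>))}"
    define U2 where "U2 = {\<omega> \<in> space M. \<Xi> [] \<omega> \<in> D2 k \<and> (\<forall>j\<in>{1..Suc k}. extinct_by n (s j) (\<lambda>w. \<Xi> (w @ [j]) \<omega>))}"
    have se: "{\<omega> \<in> space M. extinct_by n r (\<lambda>w. \<Xi> (w @ [j]) \<omega>)} \<in> events" if "1 \<le> j" for j r
      using that m by (intro sets_extinct_by) auto
    have "{\<omega> \<in> space M. \<forall>j\<in>{1..i}. extinct_by n (r j) (\<lambda>w. \<Xi> (w @ [j]) \<omega>)} \<in> events" for i r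
      by (rule sets.sets_Collect_finite_All) (use se in auto)
    then have [measurable]: "U1 \<in> events" "U2 \<in> events"
      unfolding U1_def U2_def by (auto intro!: sets.sets_Collect_conj)
    have "W k \<subseteq> U1 \<union> U2"
    proof
      fix \<omega> assume w: "\<omega> \<in> W k"
      then have \<nu>: "\<Xi> [] \<omega> \<in> point_measures" and c: "point_count (\<Xi> [] \<omega>) {0} = k"
        and e: "extinct_by (Suc n) t (\<lambda>w. \<Xi> w \<omega>)" and \<omega>: "\<omega> \<in> space M"
        using sp by (auto simp: W_def D_def E_def space_point_measure_algebra)
      note * = extinct_by_Suc[of "\<lambda>w. \<Xi> w \<omega>", OF \<nu> e h, unfolded c]
      show "\<omega> \<in> U1 \<union> U2"
        using *(1) *(2) sp[OF \<omega>] \<omega> c by (auto simp: U1_def U2_def D1_def D2_def s_def atLeastAtMostSuc_conv)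
    qed
    then have "prob (W k) \<le> prob U1 + prob U2"
      by (intro order_trans[OF finite_measure_mono measure_Un_le]) auto
    also have "prob U1 = measure Q (D1 k) * (\<Prod>j\<in>{1..k}. prob {\<omega> \<in> space M. extinct_by n t (\<lambda>w. \<Xi> (w @ [j]) \<omega>)})"
      unfolding U1_def by (rule prob_root_and_subtrees[OF iid]) measurable
    also have "\<dots> \<le> measure Q (D1 k) * (\<Prod>j\<in>{1..k}. x)"
      using sub by (intro mult_left_mono prod_mono) auto
    also have "prob U2 = measure Q (D2 k) * (\<Prod>j\<in>{1..Suc k}. prob {\<omega> \<in> space M. extinct_by n (s j) (\<lambda>w. \<Xi> (w @ [j]) \<omega>)})"
      unfolding U2_def by (rule prob_root_and_subtrees[OF iid]) measurable
    also have "\<dots> \<le> measure Q (D2 k) * (\<Prod>j\<in>{1..Suc k}. if j = Suc k then y else x)"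
      using sub by (intro mult_left_mono prod_mono) (auto simp: s_def)
    also have "(\<Prod>j\<in>{1..Suc k}. if j = Suc k then y else x) = x ^ k * y"
      by simp
    also have "measure Q (D1 k) = measure Q (D k) * (1 - \<pi>)"
    proof -
      have "measure Q (D1 k) = measure Q (D k - D2 k)"
        by (intro arg_cong[where f="measure Q"]) (auto simp: D_def D1_def D2_def)
      also have "\<dots> = measure Q (D k) - measure Q (D2 k)"
        by (intro Q.finite_measure_Diff) (auto simp: sQ D_def D2_def)
      finally show ?thesis using ind[of k] by (simp add: D_def D2_def algebra_simps)
    qed
    also have "measure Q (D2 k) = measure Q (D k) * \<pi>" using ind by (simp add: D_def D2_def)
    finally show ?thesis by (simp add: algebra_simps)
  qed
  have "(\<lambda>k. measure Q (D k) * x ^ k * (1 - \<pi> * (1 - y))) sums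
      ((\<integral>\<nu>. x ^ point_count \<nu> {0} \<partial>Q) * (1 - \<pi> * (1 - y)))"
    unfolding D_def by (intro sums_mult2 point_count_zero_sums Q.prob_space_axioms sQ x)
  from sums_le[OF Wle sumE this] show ?thesis unfolding E_def .
qed

text \<open>Induction on n for all k and all families at once. The time budget is the tail of the
  series from k on: spending \<open>h k\<close> on the extra child leaves the tail from k + 1 on,
  while children born at time 0 keep budget and index. The bound is uniform in n.\<close>

lemma prob_extinct_by_le:
  fixes h u :: "nat \<Rightarrow> real"
  assumes "iid_family M \<Xi> Q" and h: "summable h" "\<And>k. 0 \<le> h k"
    and u: "\<And>k. 0 \<le> u k" "\<And>k. u k \<le> 1"
    and ind: "\<And>k m. measure Q {\<nu> \<in> space point_measure_algebra. point_count \<nu> {0} = m \<and> emeasure \<nu> {0<..h k} \<noteq> 0} =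
      measure Q {\<nu> \<in> space point_measure_algebra. point_count \<nu> {0} = m} * \<pi> k"
    and super: "\<And>k. (\<integral>\<nu>. (1 - u k) ^ point_count \<nu> {0} \<partial>Q) * (1 - \<pi> k * u (Suc k)) \<le> 1 - u k"
  shows "prob {\<omega> \<in> space M. extinct_by n (\<Sum>i. h (i + k)) (\<lambda>w. \<Xi> w \<omega>)} \<le> 1 - u k"
  using assms(1)
proof (induction n arbitrary: k \<Xi>)
  case 0
  have "\<not> extinct_by 0 t \<nu>" for t \<nu>
    by (auto simp: extinct_by_def intro!: bexI[of _ "[]"])
  then show ?case using u(2) by simp
next
  case (Suc n)
  define t where "t k = (\<Sum>i. h (i + k))" for k
  have hs: "summable (\<lambda>i. h (i + k))" for k using h(1) by (simp add: summable_iff_shift)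
  have "t k = h k + t (Suc k)"
    using suminf_split_head[OF hs[of k]] by (simp add: t_def)
  moreover have "t (Suc k) \<ge> 0" unfolding t_def using h(2) by (intro suminf_nonneg[OF hs])
  ultimately have t: "t k - h k = t (Suc k)" "h k \<le> t k" by auto
  have "prob {\<omega> \<in> space M. extinct_by (Suc n) (t k) (\<lambda>w. \<Xi> w \<omega>)} \<le>
      (\<integral>\<nu>. (1 - u k) ^ point_count \<nu> {0} \<partial>Q) * (1 - \<pi> k * (1 - (1 - u (Suc k))))"
  proof (rule prob_extinct_by_Suc_le[OF Suc.prems h(2) t(2)])
    fix j :: nat assume "1 \<le> j"
    from iid_family_subtree[OF Suc.prems this]
    show "prob {\<omega> \<in> space M. extinct_by n (t k) (\<lambda>w. \<Xi> (w @ [j]) \<omega>)} \<le> 1 - u k"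
      "prob {\<omega> \<in> space M. extinct_by n (t k - h k) (\<lambda>w. \<Xi> (w @ [j]) \<omega>)} \<le> 1 - u (Suc k)"
      unfolding t(1) unfolding t_def by (intro Suc.IH; assumption)+
  qed (use u ind in auto)
  also have "\<dots> \<le> 1 - u k" using super[of k] by simp
  finally show ?case by (simp add: t_def)
qed

text \<open>A parent is born no later than its child, so the events that generation n is reached by
  time \<open>suminf h\<close> decrease in n. Each has probability at least \<open>u 0\<close>,
  hence so has their intersection, on which explosion occurs.\<close>

lemma explosive_if_supersolution:
  fixes h u :: "nat \<Rightarrow> real"
  assumes iid: "iid_family M \<Xi> Q" and h: "summable h" "\<And>k. 0 \<le> h k"
    and u: "\<And>k. 0 \<le> u k" "\<And>k. u k \<le> 1" "u 0 > 0"
    and ind: "\<And>k m. measure Q {\<nu> \<in> space point_measure_algebra. point_count \<nu> {0} = m \<and> emeasure \<nu> {0<..h k} \<noteq> 0} =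
      measure Q {\<nu> \<in> space point_measure_algebra. point_count \<nu> {0} = m} * \<pi> k"
    and super: "\<And>k. (\<integral>\<nu>. (1 - u k) ^ point_count \<nu> {0} \<partial>Q) * (1 - \<pi> k * u (Suc k)) \<le> 1 - u k"
  shows "explosive M \<Xi>"
proof -
  note m = iid_family_measurable[OF iid]
  define t where "t = suminf h"
  define V where "V n = {\<omega> \<in> space M. \<not> extinct_by n t (\<lambda>w. \<Xi> w \<omega>)}" for n
  have se: "{\<omega> \<in> space M. extinct_by n t (\<lambda>w. \<Xi> w \<omega>)} \<in> events" for n
    using m by (rule sets_extinct_by)
  have Vc: "V n = space M - {\<omega> \<in> space M. extinct_by n t (\<lambda>w. \<Xi> w \<omega>)}" for n
    by (auto simp: V_def)
  have Vs: "V n \<in> events" for n unfolding Vc using se by blast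
  have Vp: "prob (V n) \<ge> u 0" for n
    using prob_extinct_by_le[OF iid h u(1,2) ind super, of n 0] prob_compl[OF se[of n]]
    by (simp add: Vc t_def)
  have "decseq V"
  proof (rule decseq_SucI, rule subsetI)
    fix n \<omega> assume w: "\<omega> \<in> V (Suc n)"
    then obtain v where v: "v \<in> labels" "length v = Suc n" "birth_time (\<lambda>w. \<Xi> w \<omega>) v \<le> ennreal t"
      by (auto simp: V_def extinct_by_def not_less)
    then obtain j v' where jv: "v = j # v'" by (cases v) auto
    have "birth_time (\<lambda>w. \<Xi> w \<omega>) v' \<le> birth_time (\<lambda>w. \<Xi> w \<omega>) v" by (simp add: jv)
    then have "birth_time (\<lambda>w. \<Xi> w \<omega>) v' \<le> ennreal t" using v(3) by (rule order_trans)
    then show "\<omega> \<in> V n" using v w jv by (auto simp: V_def extinct_by_def not_less)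
  qed
  then have "(\<lambda>n. prob (V n)) \<longlonglongrightarrow> prob (\<Inter>n. V n)"
    using Vs by (intro finite_Lim_measure_decseq) auto
  then have "u 0 \<le> prob (\<Inter>n. V n)"
    using Vp by (intro LIMSEQ_le_const) auto
  also have "\<dots> \<le> prob {\<omega> \<in> space M. explosion_time (\<lambda>w. \<Xi> w \<omega>) < \<infinity>}"
  proof (rule finite_measure_mono)
    show "(\<Inter>n. V n) \<subseteq> {\<omega> \<in> space M. explosion_time (\<lambda>w. \<Xi> w \<omega>) < \<infinity>}"
      by (auto simp: V_def simp del: infinity_ennreal_def intro!: explosion_if_never_extinct[of t])
  qed (use m in \<open>rule sets_explosion_time_finite\<close>)
  finally show ?thesis using u(3) by (simp add: explosive_def)
qed

end

section \<open>Explosion\<close>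

lemma measure_eq_point_count:
  "\<nu> \<in> point_measures \<Longrightarrow> B \<in> sets halfline \<Longrightarrow> measure \<nu> B = real (point_count \<nu> B)"
  by (erule (1) point_measures_emeasure_cases) (auto simp: measure_def enn2real_of_nat)

lemma emeasure_positive_part:
  assumes "sets \<nu> = sets halfline"
  shows "emeasure (positive_part \<nu>) {0<..h} = emeasure \<nu> {0<..h}"
proof -
  have m: "{0<..} \<in> sets \<nu>" "{0<..h} \<in> sets \<nu>"
    unfolding assms by (auto simp: sets_halfline_iff)
  then have "emeasure (positive_part \<nu>) {0<..h} = (\<integral>\<^sup>+x. indicator {0<..} x * indicator {0<..h} x \<partial>\<nu>)"
    unfolding positive_part_def by (intro emeasure_density) auto
  also have "\<dots> = (\<integral>\<^sup>+x. indicator {0<..h} x \<partial>\<nu>)"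
    by (intro nn_integral_cong) (auto split: split_indicator)
  finally show ?thesis using m by simp
qed

lemma mu_plus_inv_mono: "x \<le> y \<Longrightarrow> mu_plus_inv \<mu> x \<le> mu_plus_inv \<mu> y"
  unfolding mu_plus_inv_def by (intro INF_superset_mono) (auto intro: order_trans ennreal_leI)

lemma mu_plus_inv_witness:
  assumes "mu_plus_inv \<mu> y < \<infinity>" "d > 0"
  obtains x where "0 \<le> x" "ennreal y \<le> mu_plus \<mu> x" "ennreal x \<le> mu_plus_inv \<mu> y + ennreal d"
proof -
  have "mu_plus_inv \<mu> y < mu_plus_inv \<mu> y + ennreal d"
    using assms by (cases "mu_plus_inv \<mu> y") (auto simp: ennreal_plus[symmetric] ennreal_less_iff simp del: ennreal_plus)
  then have "\<exists>x\<in>{x. 0 \<le> x \<and> ennreal y \<le> mu_plus \<mu> x}. ennreal x < mu_plus_inv \<mu> y + ennreal d"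
    unfolding mu_plus_inv_def by (simp only: INF_less_iff)
  then show ?thesis using that by (auto intro: less_imp_le)
qed

lemma reproduction_point_processD:
  assumes "reproduction_point_process M \<xi>"
  shows "prob_space M" "\<xi> \<in> measurable M point_measure_algebra"
    and "0 \<le> t \<Longrightarrow> AE \<omega> in M. emeasure (\<xi> \<omega>) {0..t} < \<infinity>"
    and "\<omega> \<in> space M \<Longrightarrow> \<xi> \<omega> \<in> point_measures"
  using assms measurable_space[of \<xi> M point_measure_algebra]
  by (auto simp: reproduction_point_process_def space_point_measure_algebra)

text \<open>Local finiteness makes the count on a bounded set finite almost surely, so the value 0
  given to infinite counts changes nothing.\<close>

lemma nn_integral_point_count_eq_intensity:
  assumes \<xi>: "reproduction_point_process M \<xi>" and B: "B \<in> sets halfline" "B \<subseteq> {0..t}" "0 \<le> t"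
  shows "(\<integral>\<^sup>+\<omega>. ennreal (real (point_count (\<xi> \<omega>) B)) \<partial>M) = emeasure (intensity M \<xi>) B"
proof -
  note \<xi> = reproduction_point_processD[OF \<xi>]
  have "AE \<omega> in M. ennreal (real (point_count (\<xi> \<omega>) B)) = emeasure (\<xi> \<omega>) B"
    using \<xi>(3)[OF B(3)] AE_space
  proof eventually_elim
    case (elim \<omega>)
    have "sets (\<xi> \<omega>) = sets halfline" using \<xi>(4)[OF elim(2)] by (simp add: point_measures_def)
    then have "emeasure (\<xi> \<omega>) B \<le> emeasure (\<xi> \<omega>) {0..t}"
      using B by (intro emeasure_mono) (auto simp: sets_halfline_iff)
    then have "emeasure (\<xi> \<omega>) B < \<infinity>" using elim(1) by (rule le_less_trans)
    from emeasure_eq_point_count[OF \<xi>(4)[OF elim(2)] B(1) this] show ?case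
      by (simp add: ennreal_of_nat_eq_real_of_nat)
  qed
  then have "(\<integral>\<^sup>+\<omega>. ennreal (real (point_count (\<xi> \<omega>) B)) \<partial>M) = (\<integral>\<^sup>+\<omega>. emeasure (\<xi> \<omega>) B \<partial>M)"
    by (rule nn_integral_cong_AE)
  then show ?thesis using emeasure_intensity[OF \<xi>(2) B(1)] by simp
qed

text \<open>Apply \<open>prob_pos_ge_mean_powr\<close> to the number of points in (0,h]. It is at
  most the number in (0,t] almost surely, so one moment bound K, and hence one constant c, serves
  all h \<le> t.\<close>

lemma prob_positive_births_ge:
  assumes \<xi>: "reproduction_point_process M \<xi>" and t: "t > 0" and \<delta>: "\<delta> > 0"
    and fin: "(\<integral>\<^sup>+ \<omega>. ennreal (measure (\<xi> \<omega>) {0<..t} powr (1 + \<delta>)) \<partial>M) < \<infinity>"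
  obtains c where "c > 0" "\<And>h m. 0 < h \<Longrightarrow> h \<le> t \<Longrightarrow> 0 < m \<Longrightarrow> ennreal m \<le> mu_plus (intensity M \<xi>) h \<Longrightarrow>
    c * m powr (1 + 1 / \<delta>) \<le> measure M {\<omega> \<in> space M. emeasure (\<xi> \<omega>) {0<..h} \<noteq> 0}"
proof -
  note \<xi>D = reproduction_point_processD[OF \<xi>]
  interpret prob_space M by fact
  note [measurable] = \<xi>D(2)
  have hl: "{0<..h} \<in> sets halfline" for h by (auto simp: sets_halfline_iff)
  define N where "N h \<omega> = point_count (\<xi> \<omega>) {0<..h}" for h \<omega>
  have N_meas [measurable]: "N h \<in> measurable M (count_space UNIV)" for h
    unfolding N_def by (rule measurable_compose[OF \<xi>D(2) measurable_point_count[OF hl]])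
  have meas: "measure (\<xi> \<omega>) {0<..h} = real (N h \<omega>)" if "\<omega> \<in> space M" for \<omega> h
    using measure_eq_point_count[OF \<xi>D(4)[OF that] hl] by (simp add: N_def)
  have int_t: "integrable M (\<lambda>\<omega>. real (N t \<omega>) powr (1 + \<delta>))"
  proof (rule integrableI_nonneg)
    have "(\<integral>\<^sup>+ \<omega>. ennreal (real (N t \<omega>) powr (1 + \<delta>)) \<partial>M) =
        (\<integral>\<^sup>+ \<omega>. ennreal (measure (\<xi> \<omega>) {0<..t} powr (1 + \<delta>)) \<partial>M)"
      by (intro nn_integral_cong) (simp add: meas)
    then show "(\<integral>\<^sup>+ \<omega>. ennreal (real (N t \<omega>) powr (1 + \<delta>)) \<partial>M) < \<infinity>" using fin by simp
  qed auto
  \<comment> \<open>The summand 1 keeps K positive even if the moment is 0.\<close>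
  define K where "K = expectation (\<lambda>\<omega>. real (N t \<omega>) powr (1 + \<delta>)) + 1"
  have K: "K > 0" unfolding K_def by (intro add_nonneg_pos integral_nonneg_AE) auto
  define c where "c = (1 / 2) * (1 / (2 * K)) powr (1 / \<delta>)"
  have "c > 0" using K by (simp add: c_def)
  moreover have "c * m powr (1 + 1 / \<delta>) \<le> prob {\<omega> \<in> space M. emeasure (\<xi> \<omega>) {0<..h} \<noteq> 0}"
    if h: "0 < h" "h \<le> t" and m: "0 < m" "ennreal m \<le> mu_plus (intensity M \<xi>) h" for h m
  proof -
    have "AE \<omega> in M. N h \<omega> \<le> N t \<omega>"
      using \<xi>D(3)[OF less_imp_le[OF t]] AE_space
    proof eventually_elim
      case (elim \<omega>)
      have s: "sets (\<xi> \<omega>) = sets halfline" using \<xi>D(4)[OF elim(2)] by (simp add: point_measures_def)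
      have "emeasure (\<xi> \<omega>) {0<..t} \<le> emeasure (\<xi> \<omega>) {0..t}"
        unfolding s by (intro emeasure_mono) (auto simp: s sets_halfline_iff)
      then have "emeasure (\<xi> \<omega>) {0<..t} \<noteq> \<infinity>" using elim(1) by auto
      moreover have "{0<..h} \<subseteq> {0<..t}" using h by auto
      ultimately have "measure (\<xi> \<omega>) {0<..h} \<le> measure (\<xi> \<omega>) {0<..t}"
        using hl s by (intro measure_mono_fmeasurable) (auto simp: fmeasurable_def less_top)
      then show ?case by (simp add: meas elim(2))
    qed
    then have le: "AE \<omega> in M. real (N h \<omega>) powr (1 + \<delta>) \<le> real (N t \<omega>) powr (1 + \<delta>)"
      by eventually_elim (use \<delta> in \<open>auto intro!: powr_mono2\<close>)
    have ip: "integrable M (\<lambda>\<omega>. real (N h \<omega>) powr (1 + \<delta>))"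
      by (rule Bochner_Integration.integrable_bound[OF int_t]) (use le in auto)
    have "real k \<le> real k powr (1 + \<delta>)" for k
      using powr_mono[of 1 "1 + \<delta>" "real k"] \<delta> by (cases "k = 0") auto
    then have i1: "integrable M (\<lambda>\<omega>. real (N h \<omega>))"
      by (intro Bochner_Integration.integrable_bound[OF ip]) auto
    have "ennreal m \<le> (\<integral>\<^sup>+\<omega>. ennreal (real (N h \<omega>)) \<partial>M)"
      unfolding N_def using m(2) h
      by (subst nn_integral_point_count_eq_intensity[OF \<xi> hl, where t=h]) (auto simp: mu_plus_def)
    also have "\<dots> = ennreal (expectation (\<lambda>\<omega>. real (N h \<omega>)))"
      by (intro nn_integral_eq_integral i1) auto
    finally have "m \<le> expectation (\<lambda>\<omega>. real (N h \<omega>))"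
      by (subst (asm) ennreal_le_iff) (auto intro: integral_nonneg_AE)
    moreover have "expectation (\<lambda>\<omega>. real (N h \<omega>) powr (1 + \<delta>)) \<le> K"
      using integral_mono_AE[OF ip int_t le] by (simp add: K_def)
    ultimately have "c * m powr (1 + 1 / \<delta>) \<le> prob {\<omega> \<in> space M. N h \<omega> \<noteq> 0}"
      unfolding c_def using i1 ip K \<delta> m by (intro prob_pos_ge_mean_powr) auto
    also have "\<dots> \<le> prob {\<omega> \<in> space M. emeasure (\<xi> \<omega>) {0<..h} \<noteq> 0}"
      by (intro finite_measure_mono) (auto simp: N_def point_count_def measure_def)
    finally show ?thesis .
  qed
  ultimately show ?thesis using that by blast
qed

lemma indep_zero_and_positive_births:
  assumes \<xi>: "reproduction_point_process M \<xi>"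
    and indep: "indep_elements M borel (\<lambda>\<omega>. emeasure (\<xi> \<omega>) {0})
              point_measure_algebra (\<lambda>\<omega>. positive_part (\<xi> \<omega>))"
  shows "measure (distr M point_measure_algebra \<xi>)
      {\<nu> \<in> space point_measure_algebra. point_count \<nu> {0} = m \<and> emeasure \<nu> {0<..h} \<noteq> 0} =
    measure (distr M point_measure_algebra \<xi>) {\<nu> \<in> space point_measure_algebra. point_count \<nu> {0} = m} *
    measure M {\<omega> \<in> space M. emeasure (\<xi> \<omega>) {0<..h} \<noteq> 0}"
proof -
  note \<xi>D = reproduction_point_processD[OF \<xi>]
  interpret prob_space M by fact
  note [measurable] = \<xi>D(2)
  have [measurable]: "(\<lambda>\<nu>. point_count \<nu> {0}) \<in> measurable point_measure_algebra (count_space UNIV)"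
    by (rule measurable_point_count) (simp add: sets_halfline_iff)
  \<comment> \<open>Independence is stated for the extended mass at 0, so the count is expressed as
    a Borel condition on that mass.\<close>
  let ?A = "{e :: ennreal. nat \<lfloor>enn2real e\<rfloor> = m}"
  let ?B = "{\<nu> \<in> space point_measure_algebra. emeasure \<nu> {0<..h} \<noteq> 0}"
  have A: "?A \<in> sets borel" by measurable
  have B: "?B \<in> sets point_measure_algebra" by measurable
  have pp: "positive_part (\<xi> \<omega>) \<in> space point_measure_algebra" if "\<omega> \<in> space M" for \<omega>
    using indep that by (auto simp: indep_elements_def dest: measurable_space)
  have eB: "(\<lambda>\<omega>. positive_part (\<xi> \<omega>)) -` ?B \<inter> space M = {\<omega> \<in> space M. emeasure (\<xi> \<omega>) {0<..h} \<noteq> 0}"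
    using pp \<xi>D(4) by (auto simp: emeasure_positive_part point_measures_def)
  have eA: "(\<lambda>\<omega>. emeasure (\<xi> \<omega>) {0}) -` ?A \<inter> space M = {\<omega> \<in> space M. point_count (\<xi> \<omega>) {0} = m}"
    by (auto simp: point_count_def measure_def)
  have "prob (((\<lambda>\<omega>. emeasure (\<xi> \<omega>) {0}) -` ?A \<inter> space M) \<inter> ((\<lambda>\<omega>. positive_part (\<xi> \<omega>)) -` ?B \<inter> space M)) =
      prob ((\<lambda>\<omega>. emeasure (\<xi> \<omega>) {0}) -` ?A \<inter> space M) * prob ((\<lambda>\<omega>. positive_part (\<xi> \<omega>)) -` ?B \<inter> space M)"
  proof (rule indep_setD)
    show "indep_set {(\<lambda>\<omega>. emeasure (\<xi> \<omega>) {0}) -` A \<inter> space M |A. A \<in> sets borel}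
        {(\<lambda>\<omega>. positive_part (\<xi> \<omega>)) -` B \<inter> space M |B. B \<in> sets point_measure_algebra}"
      using indep by (simp add: indep_elements_def)
  qed (use A B in blast)+
  then have *: "prob ({\<omega> \<in> space M. point_count (\<xi> \<omega>) {0} = m} \<inter> {\<omega> \<in> space M. emeasure (\<xi> \<omega>) {0<..h} \<noteq> 0}) =
      prob {\<omega> \<in> space M. point_count (\<xi> \<omega>) {0} = m} * prob {\<omega> \<in> space M. emeasure (\<xi> \<omega>) {0<..h} \<noteq> 0}"
    by (simp only: eA eB)
  have sp: "\<omega> \<in> space M \<Longrightarrow> \<xi> \<omega> \<in> space point_measure_algebra" for \<omega>
    using measurable_space[OF \<xi>D(2)] .
  have d: "measure (distr M point_measure_algebra \<xi>) {\<nu> \<in> space point_measure_algebra. R \<nu>} = prob {\<omega> \<in> space M. R (\<xi> \<omega>)}"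
    if "{\<nu> \<in> space point_measure_algebra. R \<nu>} \<in> sets point_measure_algebra" for R
    by (subst measure_distr[OF \<xi>D(2) that]) (auto intro!: arg_cong[where f=prob] sp)
  have "{\<nu> \<in> space point_measure_algebra. point_count \<nu> {0} = m \<and> emeasure \<nu> {0<..h} \<noteq> 0} \<in> sets point_measure_algebra"
    "{\<nu> \<in> space point_measure_algebra. point_count \<nu> {0} = m} \<in> sets point_measure_algebra"
    by measurable
  note d = this[THEN d]
  have "{\<omega> \<in> space M. point_count (\<xi> \<omega>) {0} = m} \<inter> {\<omega> \<in> space M. emeasure (\<xi> \<omega>) {0<..h} \<noteq> 0} =
      {\<omega> \<in> space M. point_count (\<xi> \<omega>) {0} = m \<and> emeasure (\<xi> \<omega>) {0<..h} \<noteq> 0}" by blast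
  with * show ?thesis unfolding d by simp
qed

theorem theorem2p6:
  fixes M :: "'a measure" and \<xi> :: "'a \<Rightarrow> real measure"
    and P :: "'b measure" and \<Xi> :: "nat list \<Rightarrow> 'b \<Rightarrow> real measure"
  assumes "reproduction_point_process M \<xi>"
    and "measure M {\<omega> \<in> space M. emeasure (\<xi> \<omega>) {0} = 1} < 1"
    and "emeasure (intensity M \<xi>) {0} = 1"
    and "\<exists>t0>0. mu_plus (intensity M \<xi>) t0 < \<infinity>"
    and "\<forall>t>0. mu_plus (intensity M \<xi>) t > 0"
    and i: "indep_elements M borel (\<lambda>\<omega>. emeasure (\<xi> \<omega>) {0})
              point_measure_algebra (\<lambda>\<omega>. positive_part (\<xi> \<omega>))"
    and ii: "\<exists>\<alpha> G. 1 < \<alpha> \<and> \<alpha> \<le> 2 \<and> stable_law \<alpha> G \<and>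
              in_domain_of_attraction (distr M borel (\<lambda>\<omega>. measure (\<xi> \<omega>) {0})) G"
    and iii: "\<exists>t>0. \<exists>\<delta>>0.
              (\<integral>\<^sup>+ \<omega>. ennreal (measure (\<xi> \<omega>) {0<..t} powr (1 + \<delta>)) \<partial>M) < \<infinity>"
    and iv: "\<exists>\<epsilon>. 0 < \<epsilon> \<and> \<epsilon> < 1 \<and>
              (\<integral>\<^sup>+ x\<in>{0<..<\<epsilon>}. mu_plus_inv (intensity M \<xi>) x / ennreal (x * \<bar>ln x\<bar>) \<partial>lborel) < \<infinity>"
    and "prob_space P"
    and "iid_copies P \<Xi> M \<xi>"
  shows "explosive P \<Xi>"
proof -
  note \<xi>D = reproduction_point_processD[OF assms(1)]
  interpret M: prob_space M by fact
  interpret P: prob_space P by fact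
  note [measurable] = \<xi>D(2)
  define \<mu> where "\<mu> = intensity M \<xi>"
  define Q where "Q = distr M point_measure_algebra \<xi>"
  define X where "X \<omega> = point_count (\<xi> \<omega>) {0}" for \<omega>
  have z: "{0} \<in> sets halfline" by (simp add: sets_halfline_iff)
  have X_meas [measurable]: "X \<in> measurable M (count_space UNIV)"
    unfolding X_def by (rule measurable_compose[OF \<xi>D(2) measurable_point_count[OF z]])
  have X_eq: "measure (\<xi> \<omega>) {0} = real (X \<omega>)" if "\<omega> \<in> space M" for \<omega>
    using measure_eq_point_count[OF \<xi>D(4)[OF that] z] by (simp add: X_def)
  have nnX: "(\<integral>\<^sup>+\<omega>. ennreal (real (X \<omega>)) \<partial>M) = ennreal 1"
    using nn_integral_point_count_eq_intensity[OF assms(1) z, of 0] assms(3) by (simp add: X_def)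
  have intX: "integrable M (\<lambda>\<omega>. real (X \<omega>))" using nnX by (intro integrableI_nonneg) auto
  have EX: "M.expectation (\<lambda>\<omega>. real (X \<omega>)) = 1"
    using nnX by (subst integral_eq_nn_integral) auto

  obtain \<alpha> G where \<alpha>: "1 < \<alpha>" "\<alpha> \<le> 2" and G: "stable_law \<alpha> G"
    and attr: "in_domain_of_attraction (distr M borel (\<lambda>\<omega>. measure (\<xi> \<omega>) {0})) G"
    using ii by blast
  define p where "p = (1 + \<alpha>) / 2"
  have p: "1 < p" "p \<le> 2" "p < \<alpha>" using \<alpha> by (auto simp: p_def)
  have [measurable]: "(\<lambda>\<omega>. measure (\<xi> \<omega>) {0}) \<in> borel_measurable M"
    unfolding measure_def by measurable
  have "(\<integral>\<^sup>+x. ennreal (\<bar>x\<bar> powr p) \<partial>distr M borel (\<lambda>\<omega>. measure (\<xi> \<omega>) {0})) < \<infinity>"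
    using p by (intro domain_of_attraction_moment[OF _ G \<alpha>(1) attr]) (auto intro!: M.real_distribution_distr)
  also have "(\<integral>\<^sup>+x. ennreal (\<bar>x\<bar> powr p) \<partial>distr M borel (\<lambda>\<omega>. measure (\<xi> \<omega>) {0})) =
      (\<integral>\<^sup>+\<omega>. ennreal (real (X \<omega>) powr p) \<partial>M)"
    by (subst nn_integral_distr) (auto simp: X_eq intro!: nn_integral_cong)
  finally have intXp: "integrable M (\<lambda>\<omega>. real (X \<omega>) powr p)" by (intro integrableI_nonneg) auto
  define C where "C = M.expectation (\<lambda>\<omega>. real (X \<omega>) powr p)"
  have C: "C \<ge> 0" unfolding C_def by (intro integral_nonneg_AE) auto
  have gen: "(\<integral>\<nu>. (1 - u) ^ point_count \<nu> {0} \<partial>Q) \<le> 1 - u + C * u powr p" if "0 \<le> u" "u \<le> 1" for u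
  proof -
    have [measurable]: "(\<lambda>\<nu>. point_count \<nu> {0}) \<in> measurable point_measure_algebra (count_space UNIV)"
      by (rule measurable_point_count[OF z])
    have "(\<integral>\<nu>. (1 - u) ^ point_count \<nu> {0} \<partial>Q) = M.expectation (\<lambda>\<omega>. (1 - u) ^ X \<omega>)"
      unfolding Q_def X_def by (rule integral_distr) measurable
    also have "\<dots> \<le> 1 - u * M.expectation (\<lambda>\<omega>. real (X \<omega>)) + u powr p * M.expectation (\<lambda>\<omega>. real (X \<omega>) powr p)"
      using that p by (intro M.generating_function_le intX intXp) auto
    finally show ?thesis by (simp add: EX C_def mult.commute)
  qed

  obtain t \<delta> where t: "t > 0" and \<delta>: "\<delta> > 0"
    and fin: "(\<integral>\<^sup>+ \<omega>. ennreal (measure (\<xi> \<omega>) {0<..t} powr (1 + \<delta>)) \<partial>M) < \<infinity>"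
    using iii by blast
  define \<pi> where "\<pi> h = measure M {\<omega> \<in> space M. emeasure (\<xi> \<omega>) {0<..h} \<noteq> 0}" for h
  obtain c where c: "c > 0" and \<pi>: "\<And>h m. 0 < h \<Longrightarrow> h \<le> t \<Longrightarrow> 0 < m \<Longrightarrow> ennreal m \<le> mu_plus \<mu> h \<Longrightarrow>
      c * m powr (1 + 1 / \<delta>) \<le> \<pi> h"
    by (rule prob_positive_births_ge[OF assms(1) t \<delta> fin, folded \<pi>_def \<mu>_def]) (rule that)
  have \<kappa>: "1 + 1 / \<delta> > 0" using \<delta> by (simp add: add_pos_pos)
  obtain q \<eta> y0 where q: "q > 1" and \<eta>: "\<eta> > 0" and y0: "y0 > 0"
    and par: "\<And>y. 0 < y \<Longrightarrow> y \<le> y0 \<Longrightarrow> y powr \<eta> \<le> 1 / 2"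
      "\<And>y r. 0 < y \<Longrightarrow> y \<le> y0 \<Longrightarrow> c * y powr (1 + 1 / \<delta>) \<le> r \<Longrightarrow> r \<le> 1 \<Longrightarrow>
        (1 - y powr \<eta> + C * (y powr \<eta>) powr p) * (1 - r * (y powr q) powr \<eta>) \<le> 1 - y powr \<eta>"
    using supersolution_parameters[OF p(1,2) c C \<kappa>] by metis
  obtain \<epsilon> where \<epsilon>: "0 < \<epsilon>" "\<epsilon> < 1"
    and int: "(\<integral>\<^sup>+ x\<in>{0<..<\<epsilon>}. mu_plus_inv \<mu> x / ennreal (x * \<bar>ln x\<bar>) \<partial>lborel) < \<infinity>"
    using iv unfolding \<mu>_def by blast
  \<comment> \<open>Levels up to \<open>y1\<close> are already reached at time t, which allows the
    delays to be cut off at t.\<close>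
  have "mu_plus \<mu> t > 0" using assms(5) t by (simp add: \<mu>_def)
  then obtain y1 where y1: "y1 > 0" "ennreal y1 \<le> mu_plus \<mu> t"
    by (cases "mu_plus \<mu> t") (auto intro: that[of 1])
  define y where "y = min (min y0 y1) (\<epsilon> / 2)"
  have y: "0 < y" "y < \<epsilon>" "y < 1" "y \<le> y0" "y \<le> y1" using y0 y1 \<epsilon> by (auto simp: y_def)
  \<comment> \<open>The exponent starts at \<open>Suc n\<close> because the series is compared with
    left endpoints of blocks below y.\<close>
  define s where "s n = y powr (q ^ Suc n)" for n
  have s: "0 < s n" "s n \<le> y" "s (Suc n) = s n powr q" for n
  proof -
    have "1 \<le> q ^ Suc n" using q by (intro one_le_power) simp
    then show "s n \<le> y" using powr_mono'[of 1 "q ^ Suc n" y] y by (simp add: s_def)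
  qed (use y in \<open>auto simp: s_def powr_powr mult_ac\<close>)
  have sum: "(\<Sum>n. mu_plus_inv \<mu> (s n)) < \<infinity>"
    unfolding s_def by (rule suminf_inverse_doubly_exponential[OF mu_plus_inv_mono int y(1-3) q])
  have "mu_plus_inv \<mu> (s n) < \<infinity>" for n
    using sum_le_suminf[of "\<lambda>n. mu_plus_inv \<mu> (s n)" "{n}"] sum by (auto intro: le_less_trans)
  \<comment> \<open>Instead of attaining the infimum, a summable slack (1/2)^n is allowed.\<close>
  then have "\<exists>x\<ge>0. ennreal (s n) \<le> mu_plus \<mu> x \<and> ennreal x \<le> mu_plus_inv \<mu> (s n) + ennreal ((1 / 2) ^ n)" for n
    using mu_plus_inv_witness[of \<mu> "s n" "(1 / 2) ^ n"] by (metis half_gt_zero zero_less_one zero_less_power)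
  then obtain x where x: "\<And>n. 0 \<le> x n" "\<And>n. ennreal (s n) \<le> mu_plus \<mu> (x n)"
      "\<And>n. ennreal (x n) \<le> mu_plus_inv \<mu> (s n) + ennreal ((1 / 2) ^ n)"
    by metis
  \<comment> \<open>The lower bound for \<pi> is available only for delays up to t.\<close>
  define h where "h n = min (x n) t" for n
  have x_pos: "x n > 0" for n
  proof (rule ccontr)
    assume "\<not> x n > 0"
    then have "mu_plus \<mu> (x n) = 0" by (simp add: mu_plus_def)
    then show False using x(2)[of n] s(1)[of n] by simp
  qed
  have h: "0 < h n" "h n \<le> t" "ennreal (s n) \<le> mu_plus \<mu> (h n)" for n
    using x_pos[of n] t x(2)[of n] order_trans[OF ennreal_leI[OF order_trans[OF s(2) y(5)]] y1(2), of n]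
    by (auto simp: h_def min_def)
  have h_sum: "summable h"
  proof (rule summable_suminf_not_top)
    have "(\<Sum>n. ennreal (h n)) \<le> (\<Sum>n. mu_plus_inv \<mu> (s n) + ennreal ((1 / 2) ^ n))"
      by (intro suminf_le summableI order_trans[OF ennreal_leI x(3)]) (simp add: h_def)
    also have "\<dots> = (\<Sum>n. mu_plus_inv \<mu> (s n)) + (\<Sum>n. ennreal ((1 / 2) ^ n))"
      by (rule suminf_add[symmetric]) (auto intro: summableI)
    also have "\<dots> < \<infinity>"
      using sum by (subst suminf_ennreal2) (auto intro!: summable_geometric)
    finally show "(\<Sum>n. ennreal (h n)) \<noteq> top" by simp
  qed (use h(1) in \<open>auto intro: less_imp_le\<close>)
  show ?thesis
  proof (rule P.explosive_if_supersolution)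
    show "iid_family P \<Xi> Q"
      using assms(11) by (simp add: iid_copies_def iid_family_def Q_def)
    show "summable h" by (rule h_sum)
    show "0 \<le> h k" for k using h(1)[of k] by simp
    show "0 \<le> s k powr \<eta>" for k by simp
    show "s k powr \<eta> \<le> 1" for k using par(1)[of "s k"] s(1,2)[of k] y(4) by simp
    show "s 0 powr \<eta> > 0" using s(1)[of 0] by simp
    show "measure Q {\<nu> \<in> space point_measure_algebra. point_count \<nu> {0} = m \<and> emeasure \<nu> {0<..h k} \<noteq> 0} =
        measure Q {\<nu> \<in> space point_measure_algebra. point_count \<nu> {0} = m} * \<pi> (h k)" for k m
      unfolding Q_def \<pi>_def by (rule indep_zero_and_positive_births[OF assms(1) i])
    fix k
    have sk: "0 < s k" "s k \<le> y0" using s[of k] y(4) by auto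
    have \<pi>k: "c * s k powr (1 + 1 / \<delta>) \<le> \<pi> (h k)" "\<pi> (h k) \<le> 1"
      using \<pi>[OF h(1,2) s(1) h(3)] by (auto simp: \<pi>_def)
    have half: "s k powr \<eta> \<le> 1 / 2" "s (Suc k) powr \<eta> \<le> 1 / 2"
      using par(1)[OF sk] par(1)[of "s (Suc k)"] s(1,2)[of "Suc k"] y(4) by auto
    \<comment> \<open>This makes the second factor nonnegative, so the bound for the generating
      function may be multiplied by it.\<close>
    have "\<pi> (h k) * s (Suc k) powr \<eta> \<le> 1 * 1"
      using \<pi>k half by (intro mult_mono) auto
    then have "(\<integral>\<nu>. (1 - s k powr \<eta>) ^ point_count \<nu> {0} \<partial>Q) * (1 - \<pi> (h k) * s (Suc k) powr \<eta>) \<le>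
        (1 - s k powr \<eta> + C * (s k powr \<eta>) powr p) * (1 - \<pi> (h k) * s (Suc k) powr \<eta>)"
      using half by (intro mult_right_mono gen) auto
    also have "\<dots> \<le> 1 - s k powr \<eta>"
      unfolding s(3) by (rule par(2)[OF sk \<pi>k])
    finally show "(\<integral>\<nu>. (1 - s k powr \<eta>) ^ point_count \<nu> {0} \<partial>Q) * (1 - \<pi> (h k) * s (Suc k) powr \<eta>) \<le>
        1 - s k powr \<eta>" .
  qed
qed

end
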